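(* Let $V$ be a vertex operator algebra, $n\ge 0$ an integer and $0\le s,t\le n$. Then $\mathbf{O}_n(V)\subset O_{t,s}(V)$, and the identity map on $V$ induces an epimorphism of $A_n(V)$-bimodules from $\mathbf{A}_n(V)$ onto $A_{t,s}(V)$.
   Context: $V=(V,Y,\mathbf 1,\omega)$ is a vertex operator algebra over $\mathbb C$, $Y(\omega,z)=\sum_{m}L(m)z^{-m-2}$. All products below are given for homogeneous $u\in V$ and extended linearly. $A_n(V)=V/O_n(V)$ is the associative algebra where $O_n(V)$ is the span of all $L(-1)u+L(0)u$ and $u\circ_nv=\mathrm{Res}_zY(u,z)v\frac{(1+z)^{\mathrm{wt}\,u+n}}{z^{2n+2}}$, with product induced by $u*_nv=\sum_{m=0}^n(-1)^m\binom{m+n}{n}\mathrm{Res}_zY(u,z)v\frac{(1+z)^{\mathrm{wt}\,u+n}}{z^{n+m+1}}$. For $s\le n$ the identity on $V$ induces an algebra epimorphism $A_n(V)\to A_s(V)$, so $A_t(V)$-$A_s(V)$-bimodules with $s,t\le n$ are $A_n(V)$-bimodules. $\mathbf{O}_n(V)$ is the span of the $u\circ_nv$ only, and $\mathbf{A}_n(V)=V/\mathbf{O}_n(V)$ is an $A_n(V)$-bimodule with left action of $u$ on $w$ induced by $u*_nw$ (formula above) and right action of $u$ on $w$ induced by $w*_nu=\sum_{m=0}^n(-1)^n\binom{m+n}{n}\mathrm{Res}_zY(u,z)w\frac{(1+z)^{\mathrm{wt}\,u+m-1}}{z^{n+m+1}}$. The $A_t(V)$-$A_s(V)$-bimodule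 $A_{t,s}(V)$ (Dong–Jiang): for nonnegative integers $s,t,p$ put $$u*_{s,p}^{t}v=\sum_{i=0}^{p}(-1)^i\binom{s+t-p+i}{i}\mathrm{Res}_z\frac{(1+z)^{\mathrm{wt}\,u+s}}{z^{s+t-p+i+1}}Y(u,z)v .$$ Let $O'_{t,s}(V)$ be the span of all $L(-1)u+(L(0)+s-t)u$ and $u\circ_s^tv=\mathrm{Res}_z\frac{(1+z)^{\mathrm{wt}\,u+s}}{z^{t+s+2}}Y(u,z)v$; let $O''_{t,s}(V)$ be the span of all $u*_{s,p_3}^{t}\big((a*_{p_1,p_2}^{p_3}b)*_{s,p_1}^{p_3}c-a*_{s,p_2}^{p_3}(b*_{s,p_1}^{p_2}c)\big)$ for $a,b,c,u\in V$ and $p_1,p_2,p_3\in\mathbb Z_{\ge0}$; let $O'''_{t,s}(V)=\sum_{p_1,p_2\ge 0}\big(V*_{p_1,p_2}^{t}O'_{p_2,p_1}(V)\big)*_{s,p_1}^{t}V$. Then $O_{t,s}(V)=O'_{t,s}(V)+O''_{t,s}(V)+O'''_{t,s}(V)$ and $A_{t,s}(V)=V/O_{t,s}(V)$, where $u\in V$ acts on the left (through $A_t(V)$) by $w\mapsto u*_{s,t}^{t}w$ and on the right (through $A_s(V)$) by $w\mapsto w*_{s,s}^{t}u$. *)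

theory Defs
  imports
    Complex_Main
    "HOL-Library.FuncSet"
    "HOL-Library.Groups_Big_Fun"
    "HOL-Library.Set_Algebras"
begin

section \<open>Vertex operator algebras\<close>

text \<open>
  The underlying complex vector space is a whole type \<open>'v\<close> with scalar multiplication \<open>smul\<close>.
  The vertex operators are given by their modes:
  \<open>Y(u,z)v = (\<Sum>m. (mode V u m v) z^(-m-1))\<close>, with \<open>m\<close> ranging over the integers.
\<close>

record 'v vertex_data =
  smul :: "complex \<Rightarrow> 'v \<Rightarrow> 'v"
  mode :: "'v \<Rightarrow> int \<Rightarrow> 'v \<Rightarrow> 'v"
  vacuum :: 'v
  conformal :: 'v

text \<open>Binomial coefficients \<open>a(a-1)\<dots>(a-i+1)/i!\<close> with an arbitrary integer as upper entry.\<close>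

abbreviation ibinom :: "int \<Rightarrow> nat \<Rightarrow> complex" where
  "ibinom a i \<equiv> (of_int a :: complex) gchoose i"

definition Vir :: "'v vertex_data \<Rightarrow> int \<Rightarrow> 'v \<Rightarrow> 'v" where
  "Vir V m v = mode V (conformal V) (m + 1) v"

definition weight_space :: "'v vertex_data \<Rightarrow> int \<Rightarrow> 'v set" where
  "weight_space V k = {v. Vir V 0 v = smul V (of_int k) v}"

definition weight_decomposition ::
    "'v::ab_group_add vertex_data \<Rightarrow> 'v \<Rightarrow> (int \<Rightarrow> 'v) \<Rightarrow> bool" where
  "weight_decomposition V v c \<longleftrightarrow>
     (\<forall>k. c k \<in> weight_space V k) \<and> finite {k. c k \<noteq> 0} \<and> v = (\<Sum>k | c k \<noteq> 0. c k)"

definition weight_component :: "'v::ab_group_add vertex_data \<Rightarrow> int \<Rightarrow> 'v \<Rightarrow> 'v" where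
  "weight_component V k v = (THE c. weight_decomposition V v c) k"

text \<open>
  The axiom \<open>borcherds\<close> is the Jacobi identity in components: it compares the coefficients of
  \<open>z0^(-l-1) z1^(-m-1) z2^(-n-1)\<close>.  By \<open>truncation\<close> every \<open>Sum_any\<close> occurring in it is a
  finite sum.
\<close>

locale vertex_operator_algebra = vector_space "smul V"
  for V :: "'v::ab_group_add vertex_data" +
  assumes mode_add_left: "mode V (u + u') m v = mode V u m v + mode V u' m v"
    and mode_scale_left: "mode V (smul V a u) m v = smul V a (mode V u m v)"
    and mode_add_right: "mode V u m (v + v') = mode V u m v + mode V u m v'"
    and mode_scale_right: "mode V u m (smul V a v) = smul V a (mode V u m v)"
    and truncation: "\<exists>N. \<forall>m\<ge>N. mode V u m v = 0"
    and vacuum_mode: "mode V (vacuum V) m v = (if m = -1 then v else 0)"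
    and creation: "mode V v (-1) (vacuum V) = v"
      "m \<ge> 0 \<Longrightarrow> mode V v m (vacuum V) = 0"
    and borcherds:
      "Sum_any (\<lambda>i::nat. smul V (ibinom m i) (mode V (mode V u (l + int i) v) (m + n - int i) w))
       = Sum_any (\<lambda>i::nat. smul V ((-1) ^ i * ibinom l i)
                   (mode V u (m + l - int i) (mode V v (n + int i) w)))
       - Sum_any (\<lambda>i::nat. smul V ((-1) ^ i * ibinom l i * (-1) powi l)
                   (mode V v (n + l - int i) (mode V u (m + int i) w)))"
    and virasoro: "\<exists>c. \<forall>m n v. Vir V m (Vir V n v) - Vir V n (Vir V m v)
       = smul V (of_int (m - n)) (Vir V (m + n) v)
         + (if m + n = 0 then smul V (of_int (m ^ 3 - m) / 12 * c) v else 0)"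
    and derivative: "mode V (Vir V (-1) u) m v = smul V (- of_int m) (mode V u (m - 1) v)"
    and grading: "\<exists>!c. weight_decomposition V v c"
    and weight_space_finite_dim: "\<exists>B. finite B \<and> weight_space V k \<subseteq> span B"
    and grading_bounded_below: "\<exists>N. \<forall>k<N. weight_space V k = {0}"
    and vacuum_weight: "vacuum V \<in> weight_space V 0"
    and conformal_weight: "conformal V \<in> weight_space V 2"

section \<open>Products\<close>

text \<open>
  \<open>residue V a b u v\<close> is \<open>Res_z Y(u,z)v (1+z)^a / z^b\<close>, with \<open>(1+z)^a\<close> expanded in
  nonnegative powers of \<open>z\<close>.
\<close>

definition residue :: "'v::ab_group_add vertex_data \<Rightarrow> int \<Rightarrow> int \<Rightarrow> 'v \<Rightarrow> 'v \<Rightarrow> 'v" where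
  "residue V a b u v = Sum_any (\<lambda>i::nat. smul V (ibinom a i) (mode V u (int i - b) v))"

text \<open>Linear extension of an expression \<open>F k u\<close> given for homogeneous \<open>u\<close> of weight \<open>k\<close>.\<close>

definition weight_extend ::
    "'v::ab_group_add vertex_data \<Rightarrow> (int \<Rightarrow> 'v \<Rightarrow> 'v) \<Rightarrow> 'v \<Rightarrow> 'v" where
  "weight_extend V F u =
     (\<Sum>k | weight_component V k u \<noteq> 0. F k (weight_component V k u))"

definition circ_n :: "'v::ab_group_add vertex_data \<Rightarrow> nat \<Rightarrow> 'v \<Rightarrow> 'v \<Rightarrow> 'v" where
  "circ_n V n u v = weight_extend V (\<lambda>k u. residue V (k + int n) (2 * int n + 2) u v) u"

definition star_n :: "'v::ab_group_add vertex_data \<Rightarrow> nat \<Rightarrow> 'v \<Rightarrow> 'v \<Rightarrow> 'v" where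
  "star_n V n u v = weight_extend V
     (\<lambda>k u. \<Sum>m = 0..n. smul V ((-1) ^ m * of_nat ((m + n) choose n))
        (residue V (k + int n) (int n + int m + 1) u v)) u"

text \<open>
  The right action of \<open>u\<close> on \<open>w\<close>.  It uses \<open>Y(u,z)w\<close> and differs from
  \<open>star_n V n w u\<close>, which uses \<open>Y(w,z)u\<close>.
\<close>

definition right_star_n :: "'v::ab_group_add vertex_data \<Rightarrow> nat \<Rightarrow> 'v \<Rightarrow> 'v \<Rightarrow> 'v" where
  "right_star_n V n w u = weight_extend V
     (\<lambda>k u. \<Sum>m = 0..n. smul V ((-1) ^ n * of_nat ((m + n) choose n))
        (residue V (k + int m - 1) (int n + int m + 1) u w)) u"

text \<open>
  \<open>dj_star V t s p u v\<close> is \<open>u *\<^sub>s\<^sub>,\<^sub>p\<^sup>t v\<close> and \<open>dj_circ V t s u v\<close> is the product with lower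
  index \<open>s\<close> and upper index \<open>t\<close>.  Here \<open>s + t - p + i\<close> may be negative.
\<close>

definition dj_star :: "'v::ab_group_add vertex_data \<Rightarrow> nat \<Rightarrow> nat \<Rightarrow> nat \<Rightarrow> 'v \<Rightarrow> 'v \<Rightarrow> 'v" where
  "dj_star V t s p u v = weight_extend V
     (\<lambda>k u. \<Sum>i = 0..p.
        smul V ((-1) ^ i * ibinom (int s + int t - int p + int i) i)
          (residue V (k + int s) (int s + int t - int p + int i + 1) u v)) u"

definition dj_circ :: "'v::ab_group_add vertex_data \<Rightarrow> nat \<Rightarrow> nat \<Rightarrow> 'v \<Rightarrow> 'v \<Rightarrow> 'v" where
  "dj_circ V t s u v = weight_extend V
     (\<lambda>k u. residue V (k + int s) (int t + int s + 2) u v) u"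

section \<open>The subspaces\<close>

abbreviation vspan :: "'v::ab_group_add vertex_data \<Rightarrow> 'v set \<Rightarrow> 'v set" where
  "vspan V \<equiv> module.span (smul V)"

definition bold_O :: "'v::ab_group_add vertex_data \<Rightarrow> nat \<Rightarrow> 'v set" where
  "bold_O V n = vspan V {circ_n V n u v | u v. True}"

definition zhu_O :: "'v::ab_group_add vertex_data \<Rightarrow> nat \<Rightarrow> 'v set" where
  "zhu_O V n = vspan V ({Vir V (-1) u + Vir V 0 u | u. True} \<union> {circ_n V n u v | u v. True})"

definition dj_O1 :: "'v::ab_group_add vertex_data \<Rightarrow> nat \<Rightarrow> nat \<Rightarrow> 'v set" where
  "dj_O1 V t s = vspan V
     ({Vir V (-1) u + (Vir V 0 u + smul V (of_nat s - of_nat t) u) | u. True}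
      \<union> {dj_circ V t s u v | u v. True})"

definition dj_O2 :: "'v::ab_group_add vertex_data \<Rightarrow> nat \<Rightarrow> nat \<Rightarrow> 'v set" where
  "dj_O2 V t s = vspan V
     {dj_star V t s p3 u
        (dj_star V p3 s p1 (dj_star V p3 p1 p2 a b) c
         - dj_star V p3 s p2 a (dj_star V p2 s p1 b c)) | u a b c p1 p2 p3. True}"

definition dj_O3 :: "'v::ab_group_add vertex_data \<Rightarrow> nat \<Rightarrow> nat \<Rightarrow> 'v set" where
  "dj_O3 V t s = vspan V
     {dj_star V t s p1 (dj_star V t p1 p2 a x) b | a x b p1 p2. x \<in> dj_O1 V p2 p1}"

definition dj_O :: "'v::ab_group_add vertex_data \<Rightarrow> nat \<Rightarrow> nat \<Rightarrow> 'v set" where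
  "dj_O V t s = dj_O1 V t s + dj_O2 V t s + dj_O3 V t s"

section \<open>Algebras, bimodules and their homomorphisms\<close>

record 'm linear_structure =
  carrier :: "'m set"
  add :: "'m \<Rightarrow> 'm \<Rightarrow> 'm"
  scal :: "complex \<Rightarrow> 'm \<Rightarrow> 'm"

record 'a algebra_structure = "'a linear_structure" +
  mult :: "'a \<Rightarrow> 'a \<Rightarrow> 'a"

record ('a, 'b, 'm) bimodule_structure = "'m linear_structure" +
  lact :: "'a \<Rightarrow> 'm \<Rightarrow> 'm"
  ract :: "'m \<Rightarrow> 'b \<Rightarrow> 'm"

text \<open>As with \<open>hom\<close> in the algebra library, only the compatibility conditions are listed.\<close>

definition bimodule_hom ::
    "('a, 'x) algebra_structure_scheme \<Rightarrow> ('b, 'y) algebra_structure_scheme \<Rightarrow>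
     ('a, 'b, 'm, 'z) bimodule_structure_scheme \<Rightarrow> ('a, 'b, 'k, 'w) bimodule_structure_scheme \<Rightarrow>
     ('m \<Rightarrow> 'k) set" where
  "bimodule_hom A B M N = {f. f \<in> carrier M \<rightarrow> carrier N \<and>
     (\<forall>x\<in>carrier M. \<forall>y\<in>carrier M. f (add M x y) = add N (f x) (f y)) \<and>
     (\<forall>c. \<forall>x\<in>carrier M. f (scal M c x) = scal N c (f x)) \<and>
     (\<forall>a\<in>carrier A. \<forall>x\<in>carrier M. f (lact M a x) = lact N a (f x)) \<and>
     (\<forall>b\<in>carrier B. \<forall>x\<in>carrier M. f (ract M x b) = ract N (f x) b)}"

definition bimodule_epi ::
    "('a, 'x) algebra_structure_scheme \<Rightarrow> ('b, 'y) algebra_structure_scheme \<Rightarrow>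
     ('a, 'b, 'm, 'z) bimodule_structure_scheme \<Rightarrow> ('a, 'b, 'k, 'w) bimodule_structure_scheme \<Rightarrow>
     ('m \<Rightarrow> 'k) set" where
  "bimodule_epi A B M N = {f \<in> bimodule_hom A B M N. f ` carrier M = carrier N}"

text \<open>Restriction of scalars along \<open>f\<close> on the left and \<open>g\<close> on the right.\<close>

definition restrict_scalars ::
    "('a \<Rightarrow> 'c) \<Rightarrow> ('b \<Rightarrow> 'd) \<Rightarrow> ('c, 'd, 'm) bimodule_structure \<Rightarrow>
     ('a, 'b, 'm) bimodule_structure" where
  "restrict_scalars f g M =
     \<lparr>carrier = carrier M, add = add M, scal = scal M,
      lact = (\<lambda>a. lact M (f a)), ract = (\<lambda>x b. ract M x (g b))\<rparr>"

section \<open>Quotients of the vertex operator algebra\<close>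

definition quotient_carrier :: "'v::ab_group_add set \<Rightarrow> 'v set set" where
  "quotient_carrier W = range (\<lambda>v. v +o W)"

text \<open>
  The operation on cosets induced by \<open>f\<close>, in the style of the coset operations in the algebra
  library: the value does not involve a choice of representatives, and it is the coset of
  \<open>f a b\<close> whenever that coset depends only on the cosets \<open>X\<close> of \<open>a\<close> and \<open>Z\<close> of \<open>b\<close>.
\<close>

definition induced_op ::
    "('v::ab_group_add \<Rightarrow> 'v \<Rightarrow> 'v) \<Rightarrow> 'v set \<Rightarrow> 'v set \<Rightarrow> 'v set \<Rightarrow> 'v set" where
  "induced_op f W X Z = (\<Union>a\<in>X. \<Union>b\<in>Z. f a b +o W)"

definition quotient_scal ::
    "'v::ab_group_add vertex_data \<Rightarrow> 'v set \<Rightarrow> complex \<Rightarrow> 'v set \<Rightarrow> 'v set" where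
  "quotient_scal V W c X = (\<Union>x\<in>X. smul V c x +o W)"

text \<open>For \<open>U \<subseteq> W\<close> this is the map from \<open>V/U\<close> to \<open>V/W\<close> induced by the identity.\<close>

definition quotient_map :: "'v::ab_group_add set \<Rightarrow> 'v set \<Rightarrow> 'v set" where
  "quotient_map W X = X + W"

definition zhu_A :: "'v::ab_group_add vertex_data \<Rightarrow> nat \<Rightarrow> 'v set algebra_structure" where
  "zhu_A V n =
     \<lparr>carrier = quotient_carrier (zhu_O V n), add = (+), scal = quotient_scal V (zhu_O V n),
      mult = induced_op (star_n V n) (zhu_O V n)\<rparr>"

definition bold_A ::
    "'v::ab_group_add vertex_data \<Rightarrow> nat \<Rightarrow> ('v set, 'v set, 'v set) bimodule_structure" where
  "bold_A V n =
     \<lparr>carrier = quotient_carrier (bold_O V n), add = (+), scal = quotient_scal V (bold_O V n),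
      lact = induced_op (star_n V n) (bold_O V n),
      ract = induced_op (right_star_n V n) (bold_O V n)\<rparr>"

text \<open>The bimodule over the level \<open>t\<close> algebra on the left and the level \<open>s\<close> algebra on the right.\<close>

definition dj_A ::
    "'v::ab_group_add vertex_data \<Rightarrow> nat \<Rightarrow> nat \<Rightarrow> ('v set, 'v set, 'v set) bimodule_structure"
  where
  "dj_A V t s =
     \<lparr>carrier = quotient_carrier (dj_O V t s), add = (+), scal = quotient_scal V (dj_O V t s),
      lact = induced_op (dj_star V t s t) (dj_O V t s),
      ract = induced_op (dj_star V t s s) (dj_O V t s)\<rparr>"

text \<open>The same space viewed, for \<open>s, t \<le> n\<close>, as a bimodule over the level \<open>n\<close> algebra.\<close>

definition dj_A_at ::
    "'v::ab_group_add vertex_data \<Rightarrow> nat \<Rightarrow> nat \<Rightarrow> nat \<Rightarrow>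
     ('v set, 'v set, 'v set) bimodule_structure" where
  "dj_A_at V n t s =
     restrict_scalars (quotient_map (zhu_O V t)) (quotient_map (zhu_O V s)) (dj_A V t s)"

end

theory Submission
  imports Defs "HOL-Computational_Algebra.Formal_Power_Series"
begin

text \<open>
  Write \<open>R a b\<close> for \<open>Res\<^sub>z Y(u,z)v (1+z)\<^sup>a z\<^sup>-\<^sup>b\<close> with \<open>u\<close> of weight \<open>k\<close>.  Two computations
  modulo \<open>O'\<^sub>t\<^sub>,\<^sub>s\<close> carry the proof.  First, the derivative property puts every
  \<open>R (k+s+j) (t+s+2+j+l)\<close> with \<open>j, l \<ge> 0\<close> into \<open>O'\<^sub>t\<^sub>,\<^sub>s\<close>; this gives the inclusion, and together with
  a telescoping expansion of \<open>u *\<^sub>s\<^sub>,\<^sub>t\<^sup>t v\<close> it shows that \<open>u *\<^sub>n v\<close> and \<open>u *\<^sub>s\<^sub>,\<^sub>t\<^sup>t v\<close> agree.  Second, skew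
  symmetry turns \<open>w *\<^sub>s\<^sub>,\<^sub>s\<^sup>t u\<close> into \<open>u *\<^sub>s\<^sub>,\<^sub>t\<^sup>t w - R (k-1) 0\<close>, and the right action on \<open>V/\<^bold>O\<^sub>n\<close> has the
  same form, so the right actions agree as well.

  That the actions on \<open>A\<^sub>t\<^sub>,\<^sub>s(V)\<close> do not depend on representatives is then formal: \<open>O''\<close> makes the
  products associative, \<open>O'''\<close> contains \<open>(a * O') * b\<close>, and the vacuum is a left unit exactly and a
  right unit modulo \<open>O'\<close>.
\<close>

context vertex_operator_algebra
begin

section \<open>Linear maps and subspaces\<close>

abbreviation linear_map :: "('v \<Rightarrow> 'v) \<Rightarrow> bool" where
  "linear_map \<equiv> module_hom (smul V) (smul V)"

sublocale endo: module_pair "smul V" "smul V" ..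

lemma linear_mapI:
  assumes "\<And>x y. f (x + y) = f x + f y" "\<And>c x. f (smul V c x) = smul V c (f x)"
  shows "linear_map f"
  using assms by (simp add: module_hom_iff module_axioms)

lemma linear_map_mode_left: "linear_map (\<lambda>u. mode V u m v)"
  by (rule linear_mapI) (simp_all add: mode_add_left mode_scale_left)

lemma linear_map_mode_right: "linear_map (mode V u m)"
  by (rule linear_mapI) (simp_all add: mode_add_right mode_scale_right)

lemma linear_map_Vir: "linear_map (Vir V m)"
  using linear_map_mode_right[of "conformal V" "m + 1"] by (simp add: Vir_def[abs_def])

lemma span_subset_linear_preimage:
  assumes "linear_map f" "subspace W" "\<And>x. x \<in> S \<Longrightarrow> f x \<in> W" "x \<in> span S"
  shows "f x \<in> W"
proof -
  have "subspace {x. f x \<in> W}"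
    using module_hom.subspace_linear_preimage[OF assms(1,2)] .
  then have "span S \<subseteq> {x. f x \<in> W}"
    using assms(3) by (intro span_minimal) auto
  then show ?thesis using assms(4) by auto
qed

lemma subspace_scale_cancel:
  assumes "subspace W" "c \<noteq> 0" "smul V c x \<in> W"
  shows "x \<in> W"
  using subspace_scale[OF assms(1,3), of "1 / c"] assms(2) by simp

subsection \<open>Weights and linear extension\<close>

lemma subspace_weight_space: "subspace (weight_space V k)"
  unfolding weight_space_def
  by (rule subspaceI)
    (simp_all add: module_hom.add[OF linear_map_Vir] module_hom.zero[OF linear_map_Vir]
      module_hom.scale[OF linear_map_Vir] scale_right_distrib mult.commute)

lemma weight_decompositionI:
  assumes "\<And>k. c k \<in> weight_space V k" "finite K" "\<And>k. k \<notin> K \<Longrightarrow> c k = 0" "v = sum c K"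
  shows "weight_decomposition V v c"
proof -
  have sub: "{k. c k \<noteq> 0} \<subseteq> K" using assms(3) by auto
  have "sum c K = sum c {k. c k \<noteq> 0}"
    by (rule sum.mono_neutral_right[OF assms(2) sub]) auto
  then show ?thesis
    using assms finite_subset[OF sub] by (auto simp: weight_decomposition_def)
qed

lemma weight_component_unique:
  assumes "weight_decomposition V v c"
  shows "weight_component V k v = c k"
  using grading[of v] assms by (auto simp: weight_component_def the1_equality)

lemma weight_decomposition_component: "weight_decomposition V v (\<lambda>k. weight_component V k v)"
  using theI'[OF grading[of v]] by (simp add: weight_component_def)

lemma weight_component_in: "weight_component V k v \<in> weight_space V k"
  and finite_weight_component: "finite {k. weight_component V k v \<noteq> 0}"
  and sum_weight_component: "(\<Sum>k | weight_component V k v \<noteq> 0. weight_component V k v) = v"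
  using weight_decomposition_component[of v] by (auto simp: weight_decomposition_def)

text \<open>Adding or scaling the components of decompositions gives a decomposition again, and
  decompositions are unique. The union of the two supports serves as common index set.\<close>

lemma linear_map_weight_component: "linear_map (weight_component V k)"
proof (rule linear_mapI)
  fix x y
  let ?K = "{k. weight_component V k x \<noteq> 0} \<union> {k. weight_component V k y \<noteq> 0}"
  have "sum (\<lambda>k. weight_component V k z) ?K = z" if "z = x \<or> z = y" for z
    by (subst (3) sum_weight_component[symmetric], rule sum.mono_neutral_right)
      (use that finite_weight_component in auto)
  then show "weight_component V k (x + y) = weight_component V k x + weight_component V k y"
    by (intro weight_component_unique weight_decompositionI[where K = ?K])
      (auto simp: sum.distrib finite_weight_component
        intro: weight_component_in subspace_add[OF subspace_weight_space])
next
  fix a x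
  show "weight_component V k (smul V a x) = smul V a (weight_component V k x)"
    by (rule weight_component_unique,
        rule weight_decompositionI[where K = "{k. weight_component V k x \<noteq> 0}"])
      (auto simp: sum_weight_component scale_sum_right[symmetric] finite_weight_component
        intro: weight_component_in subspace_scale[OF subspace_weight_space])
qed

lemma weight_component_homogeneous:
  assumes "u \<in> weight_space V k"
  shows "weight_component V j u = (if j = k then u else 0)"
  by (rule weight_component_unique, rule weight_decompositionI[where K = "{k}"])
    (use assms subspace_0[OF subspace_weight_space] in auto)

lemma weight_extend_superset:
  assumes "\<And>k. F k 0 = 0" "finite K" "{k. weight_component V k u \<noteq> 0} \<subseteq> K"
  shows "weight_extend V F u = (\<Sum>k\<in>K. F k (weight_component V k u))"
  unfolding weight_extend_def
  by (rule sum.mono_neutral_left) (use assms in auto)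

lemma weight_extend_homogeneous:
  assumes "F k 0 = 0" "u \<in> weight_space V k"
  shows "weight_extend V F u = F k u"
proof (cases "u = 0")
  case True
  then show ?thesis
    by (simp add: weight_extend_def module_hom.zero[OF linear_map_weight_component] assms)
next
  case False
  then have "{j. weight_component V j u \<noteq> 0} = {k}"
    by (auto simp: weight_component_homogeneous[OF assms(2)])
  then show ?thesis
    by (simp add: weight_extend_def weight_component_homogeneous[OF assms(2)])
qed

lemma linear_map_weight_extend:
  assumes "\<And>k. linear_map (F k)"
  shows "linear_map (weight_extend V F)"
proof (rule linear_mapI)
  note [simp] = module_hom.zero[OF assms]
  fix x y
  let ?K = "{k. weight_component V k x \<noteq> 0} \<union> {k. weight_component V k y \<noteq> 0}"
  have "finite ?K" using finite_weight_component by simp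
  note ext = weight_extend_superset[OF _ this]
  show "weight_extend V F (x + y) = weight_extend V F x + weight_extend V F y"
    by (subst (1 2 3) ext)
      (auto simp: module_hom.add[OF linear_map_weight_component] module_hom.add[OF assms]
        sum.distrib)
next
  note [simp] = module_hom.zero[OF assms]
  fix a x
  let ?K = "{k. weight_component V k x \<noteq> 0}"
  note ext = weight_extend_superset[OF _ finite_weight_component[of x]]
  show "weight_extend V F (smul V a x) = smul V a (weight_extend V F x)"
    by (subst (1 2) ext)
      (auto simp: module_hom.scale[OF linear_map_weight_component] module_hom.scale[OF assms]
        scale_sum_right)
qed

lemma linear_map_weight_extend_param:
  assumes "\<And>k u. linear_map (G k u)"
  shows "linear_map (\<lambda>v. weight_extend V (\<lambda>k u. G k u v) u)"
  unfolding weight_extend_def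
  by (rule endo.module_hom_sum) (simp_all add: assms module_axioms)

lemma homogeneous_induct [case_names homogeneous add]:
  assumes "\<And>k u. u \<in> weight_space V k \<Longrightarrow> P u" "\<And>x y. P x \<Longrightarrow> P y \<Longrightarrow> P (x + y)"
  shows "P u"
proof -
  have "P (\<Sum>k\<in>K. weight_component V k u)" if "finite K" for K
    using that
  proof (induction K)
    case empty
    then show ?case using assms(1)[OF subspace_0[OF subspace_weight_space]] by simp
  next
    case (insert k K)
    then show ?case
      using assms(2)[OF assms(1)[OF weight_component_in]] by simp
  qed
  from this[OF finite_weight_component[of u]] show ?thesis by (simp add: sum_weight_component)
qed

subsection \<open>Residues\<close>

lemma Sum_any_smul:
  assumes "finite {i. g i \<noteq> 0}"
  shows "Sum_any (\<lambda>i. smul V c (g i)) = smul V c (Sum_any g)"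
proof -
  have "Sum_any (\<lambda>i. smul V c (g i)) = sum (\<lambda>i. smul V c (g i)) {i. g i \<noteq> 0}"
    by (rule Sum_any.expand_superset[OF assms]) auto
  then show ?thesis by (simp add: scale_sum_right Sum_any.expand_set)
qed

lemma finite_mode_support: "finite {i::nat. smul V (f i) (mode V u (int i - b) v) \<noteq> 0}"
proof -
  obtain N where N: "\<forall>m\<ge>N. mode V u m v = 0" using truncation by blast
  have "{i::nat. smul V (f i) (mode V u (int i - b) v) \<noteq> 0} \<subseteq> {..<nat (N + b)}"
    by (auto, rule ccontr) (use N in \<open>auto simp: not_less\<close>)
  then show ?thesis by (rule finite_subset) simp
qed

lemma linear_map_residue_left: "linear_map (\<lambda>u. residue V a b u v)"
proof (rule linear_mapI)
  show "residue V a b (x + y) v = residue V a b x v + residue V a b y v" for x y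
    unfolding residue_def mode_add_left scale_right_distrib
    by (rule Sum_any.distrib) (rule finite_mode_support)+
  show "residue V a b (smul V c x) v = smul V c (residue V a b x v)" for c x
    unfolding residue_def mode_scale_left
    by (subst Sum_any_smul[OF finite_mode_support, symmetric]) (simp add: mult.commute)
qed

lemma linear_map_residue_right: "linear_map (residue V a b u)"
proof (rule linear_mapI)
  show "residue V a b u (x + y) = residue V a b u x + residue V a b u y" for x y
    unfolding residue_def mode_add_right scale_right_distrib
    by (rule Sum_any.distrib) (rule finite_mode_support)+
  show "residue V a b u (smul V c x) = smul V c (residue V a b u x)" for c x
    unfolding residue_def mode_scale_right
    by (subst Sum_any_smul[OF finite_mode_support, symmetric]) (simp add: mult.commute)
qed

text \<open>One bound \<open>M\<close> then serves several residues at once, so that index shifts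
  can be done in ordinary finite sums.\<close>

lemma residue_eq_sum:
  assumes "\<And>m. m \<ge> int M - b \<Longrightarrow> mode V u m v = 0"
  shows "residue V a b u v = (\<Sum>i<M. smul V (ibinom a i) (mode V u (int i - b) v))"
  unfolding residue_def
proof (rule Sum_any.expand_superset)
  show "{i. smul V (ibinom a i) (mode V u (int i - b) v) \<noteq> 0} \<subseteq> {..<M}"
  proof
    fix i
    assume "i \<in> {i. smul V (ibinom a i) (mode V u (int i - b) v) \<noteq> 0}"
    then show "i \<in> {..<M}"
      using assms[of "int i - b"] by (cases "i < M") auto
  qed
qed simp

lemma mode_eventually_zero: "\<exists>M::nat. \<forall>m \<ge> int M - b. mode V u m v = 0"
proof -
  obtain N where N: "\<forall>m\<ge>N. mode V u m v = 0" using truncation by blast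
  have "\<forall>m \<ge> int (nat (N + b)) - b. mode V u m v = 0"
  proof (intro allI impI)
    fix m assume "m \<ge> int (nat (N + b)) - b"
    then have "m \<ge> N" by linarith
    then show "mode V u m v = 0" using N by blast
  qed
  then show ?thesis by blast
qed

text \<open>This is \<open>(1+z)^(a+1) = (1+z)^a + z (1+z)^a\<close>, that is, Pascal's rule on
  coefficients.\<close>

lemma residue_exponent_Suc: "residue V (a + 1) b u v = residue V a b u v + residue V a (b - 1) u v"
proof -
  obtain M where M: "\<And>m. m \<ge> int M - b \<Longrightarrow> mode V u m v = 0" 
    using mode_eventually_zero by blast
  let ?f = "\<lambda>a i. smul V (ibinom a i) (mode V u (int i - b) v)"
  have "residue V (a + 1) b u v = (\<Sum>i<Suc M. ?f (a + 1) i)"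
    by (rule residue_eq_sum) (simp add: M)
  also have "\<dots> = ?f a 0 + (\<Sum>i<M. ?f (a + 1) (Suc i))"
    by (subst sum.lessThan_Suc_shift) simp
  also have "(\<Sum>i<M. ?f (a + 1) (Suc i)) =
      (\<Sum>i<M. smul V (ibinom a i) (mode V u (int i - (b - 1)) v)) + (\<Sum>i<M. ?f a (Suc i))"
  proof -
    have "?f (a + 1) (Suc i) =
        smul V (ibinom a i) (mode V u (int i - (b - 1)) v) + ?f a (Suc i)" for i
    proof -
      have "int (Suc i) - b = int i - (b - 1)" by simp
      then show ?thesis
        by (simp only: of_int_add of_int_1 gbinomial_Suc_Suc scale_left_distrib)
    qed
    then show ?thesis by (simp only: sum.distrib)
  qed
  also have "(\<Sum>i<M. smul V (ibinom a i) (mode V u (int i - (b - 1)) v)) = residue V a (b - 1) u v"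
    by (rule residue_eq_sum[symmetric]) (simp add: M)
  also have "?f a 0 + (residue V a (b - 1) u v + (\<Sum>i<M. ?f a (Suc i))) =
      (\<Sum>i<Suc M. ?f a i) + residue V a (b - 1) u v"
    by (subst sum.lessThan_Suc_shift) simp
  also have "(\<Sum>i<Suc M. ?f a i) = residue V a b u v"
    by (rule residue_eq_sum[symmetric]) (simp add: M)
  finally show ?thesis .
qed

text \<open>Integration by parts: \<open>Y(L(-1)u,z)\<close> is the derivative of
  \<open>Y(u,z)\<close>, and a total derivative has residue zero.\<close>

lemma residue_derivative:
  "residue V a b (Vir V (-1) u) v =
     smul V (of_int b) (residue V a (b + 1) u v) - smul V (of_int a) (residue V (a - 1) b u v)"
proof -
  obtain M where M: "\<And>m. m \<ge> int M - (b + 1) \<Longrightarrow> mode V u m v = 0" 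
    using mode_eventually_zero by blast
  let ?m = "\<lambda>i. mode V u (int i - (b + 1)) v"
  have "residue V a b (Vir V (-1) u) v =
      (\<Sum>i<Suc M. smul V (ibinom a i) (mode V (Vir V (-1) u) (int i - b) v))"
    by (rule residue_eq_sum) (simp add: derivative M)
  also have "\<dots> = (\<Sum>i<Suc M. smul V (of_int b) (smul V (ibinom a i) (?m i))
      - smul V (of_nat i * ibinom a i) (?m i))"
  proof (rule sum.cong[OF refl])
    fix i
    have "int i - b - 1 = int i - (b + 1)" by simp
    moreover have "ibinom a i * - of_int (int i - b) =
        of_int b * ibinom a i - of_nat i * ibinom a i"
      by (simp add: algebra_simps)
    ultimately show "smul V (ibinom a i) (mode V (Vir V (-1) u) (int i - b) v) =
        smul V (of_int b) (smul V (ibinom a i) (?m i)) - smul V (of_nat i * ibinom a i) (?m i)"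
      by (simp only: derivative scale_scale scale_left_diff_distrib)
  qed
  also have "\<dots> = smul V (of_int b) (\<Sum>i<Suc M. smul V (ibinom a i) (?m i))
      - (\<Sum>i<Suc M. smul V (of_nat i * ibinom a i) (?m i))"
    by (simp only: sum_subtractf scale_sum_right)
  also have "(\<Sum>i<Suc M. smul V (ibinom a i) (?m i)) = residue V a (b + 1) u v"
    by (rule residue_eq_sum[symmetric]) (simp add: M)
  also have "(\<Sum>i<Suc M. smul V (of_nat i * ibinom a i) (?m i)) =
      (\<Sum>i<M. smul V (of_int a * ibinom (a - 1) i) (mode V u (int i - b) v))"
  proof -
    have "smul V (of_nat (Suc i) * ibinom a (Suc i)) (?m (Suc i)) =
        smul V (of_int a * ibinom (a - 1) i) (mode V u (int i - b) v)" for i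
      by (simp add: gbinomial_absorption del: of_nat_Suc) simp
    then show ?thesis
      by (subst sum.lessThan_Suc_shift) (simp del: of_nat_Suc)
  qed
  also have "\<dots> = smul V (of_int a) (\<Sum>i<M. smul V (ibinom (a - 1) i) (mode V u (int i - b) v))"
    by (simp add: scale_sum_right)
  also have "(\<Sum>i<M. smul V (ibinom (a - 1) i) (mode V u (int i - b) v)) = residue V (a - 1) b u v"
    by (rule residue_eq_sum[symmetric]) (simp add: M)
  finally show ?thesis .
qed

subsection \<open>Weights of modes\<close>

lemma Vir_0_homogeneous: "u \<in> weight_space V k \<Longrightarrow> Vir V 0 u = smul V (of_int k) u"
  by (simp add: weight_space_def)

text \<open>The Borcherds identity with the conformal vector as first argument and upper indices 1
  and 0 is the commutator formula \<open>[L(0), u_m] = (L(-1)u)_(m+1) + (L(0)u)_m\<close>; the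
  derivative property evaluates its first term.\<close>

lemma weight_space_mode:
  assumes "u \<in> weight_space V k" "v \<in> weight_space V l"
  shows "mode V u m v \<in> weight_space V (k + l - m - 1)"
proof -
  let ?w = "conformal V"
  have choose1: "ibinom 1 i = 0" if "i \<notin> {0, 1}" for i :: nat
    using that binomial_gbinomial[of 1 i, where 'a = complex] by (simp add: binomial_eq_0)
  have "Sum_any (\<lambda>i::nat. smul V (ibinom 1 i) (mode V (mode V ?w (0 + int i) u) (1 + m - int i) v))
      = (\<Sum>i\<in>{0, 1}. smul V (ibinom 1 i) (mode V (mode V ?w (0 + int i) u) (1 + m - int i) v))"
    by (rule Sum_any.expand_superset) (use choose1 in auto)
  moreover have "Sum_any (\<lambda>i::nat. smul V ((-1) ^ i * ibinom 0 i)
        (mode V ?w (1 + 0 - int i) (mode V u (m + int i) v)))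
      = (\<Sum>i\<in>{0::nat}. smul V ((-1) ^ i * ibinom 0 i)
        (mode V ?w (1 + 0 - int i) (mode V u (m + int i) v)))"
    by (rule Sum_any.expand_superset) (auto simp: gbinomial_0_left)
  moreover have "Sum_any (\<lambda>i::nat. smul V ((-1) ^ i * ibinom 0 i * (-1) powi 0)
        (mode V u (m + 0 - int i) (mode V ?w (1 + int i) v)))
      = (\<Sum>i\<in>{0::nat}. smul V ((-1) ^ i * ibinom 0 i * (-1) powi 0)
        (mode V u (m + 0 - int i) (mode V ?w (1 + int i) v)))"
    by (rule Sum_any.expand_superset) (auto simp: gbinomial_0_left)
  ultimately have "mode V (mode V ?w 0 u) (1 + m) v + mode V (mode V ?w 1 u) m v
      = mode V ?w 1 (mode V u m v) - mode V u m (mode V ?w 1 v)"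
    using borcherds[of 1 ?w 0 u m v] by simp
  then have "mode V (Vir V (-1) u) (1 + m) v + mode V (Vir V 0 u) m v
      = Vir V 0 (mode V u m v) - mode V u m (Vir V 0 v)"
    by (simp add: Vir_def)
  then have "Vir V 0 (mode V u m v) = smul V (- of_int (1 + m)) (mode V u m v)
      + smul V (of_int k) (mode V u m v) + smul V (of_int l) (mode V u m v)"
    by (simp add: derivative Vir_0_homogeneous[OF assms(1)] Vir_0_homogeneous[OF assms(2)]
        mode_scale_left mode_scale_right eq_diff_eq del: of_int_add)
  also have "\<dots> = smul V (of_int (k + l - m - 1)) (mode V u m v)"
    by (simp only: scale_left_distrib[symmetric]) simp
  finally show ?thesis by (simp add: weight_space_def)
qed

lemma weight_space_derivative:
  assumes "u \<in> weight_space V k"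
  shows "Vir V (-1) u \<in> weight_space V (k + 1)"
  using weight_space_mode[OF conformal_weight assms, of 0] by (simp add: Vir_def add.commute)

section \<open>Linearity of the products and their values on homogeneous vectors\<close>

lemma linear_map_dj_star_left: "linear_map (\<lambda>u. dj_star V t s p u v)"
  unfolding dj_star_def
  by (rule linear_map_weight_extend)
    (intro endo.module_hom_sum endo.module_hom_scale linear_map_residue_left,
      simp_all add: module_axioms)

lemma linear_map_dj_star_right: "linear_map (dj_star V t s p u)"
  unfolding dj_star_def
  by (rule linear_map_weight_extend_param)
    (intro endo.module_hom_sum endo.module_hom_scale linear_map_residue_right,
      simp_all add: module_axioms)

lemma linear_map_right_star_right: "linear_map (right_star_n V n w)"
  unfolding right_star_n_def
  by (rule linear_map_weight_extend)
    (intro endo.module_hom_sum endo.module_hom_scale linear_map_residue_left,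
      simp_all add: module_axioms)

lemma linear_map_dj_circ_left: "linear_map (\<lambda>u. dj_circ V t s u v)"
  unfolding dj_circ_def by (intro linear_map_weight_extend linear_map_residue_left)

lemma dj_star_homogeneous:
  assumes "u \<in> weight_space V k"
  shows "dj_star V t s p u v = (\<Sum>i = 0..p.
      smul V ((-1) ^ i * ibinom (int s + int t - int p + int i) i)
        (residue V (k + int s) (int s + int t - int p + int i + 1) u v))"
  unfolding dj_star_def
  by (subst weight_extend_homogeneous[OF _ assms])
    (simp_all add: module_hom.zero[OF linear_map_residue_left])

lemma right_star_n_homogeneous:
  assumes "u \<in> weight_space V k"
  shows "right_star_n V n w u = (\<Sum>m = 0..n. smul V ((-1) ^ n * of_nat ((m + n) choose n))
      (residue V (k + int m - 1) (int n + int m + 1) u w))"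
  unfolding right_star_n_def
  by (subst weight_extend_homogeneous[OF _ assms])
    (simp_all add: module_hom.zero[OF linear_map_residue_left])

lemma dj_circ_homogeneous:
  assumes "u \<in> weight_space V k"
  shows "dj_circ V t s u v = residue V (k + int s) (int t + int s + 2) u v"
  unfolding dj_circ_def
  by (subst weight_extend_homogeneous[OF _ assms])
    (simp_all add: module_hom.zero[OF linear_map_residue_left])

lemma circ_n_eq_dj_circ: "circ_n V n = dj_circ V n n"
  by (simp add: fun_eq_iff circ_n_def dj_circ_def)

lemma star_n_eq_dj_star: "star_n V n = dj_star V n n n"
proof -
  have "ibinom (int n + int n - int n + int i) i = of_nat ((i + n) choose n)" for i
    using binomial_symmetric[of n "i + n"]
    by (simp add: binomial_gbinomial add.commute)
  then show ?thesis by (simp add: fun_eq_iff star_n_def dj_star_def)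
qed

lemma zhu_O_eq_dj_O1: "zhu_O V n = dj_O1 V n n"
  by (simp add: zhu_O_def dj_O1_def circ_n_eq_dj_circ)

subsection \<open>Residues with a pole of high order\<close>

lemma subspace_dj_O1: "subspace (dj_O1 V t s)"
  by (simp add: dj_O1_def)

lemma derivative_mem_dj_O1:
  "Vir V (-1) u + (Vir V 0 u + smul V (of_nat s - of_nat t) u) \<in> dj_O1 V t s"
  unfolding dj_O1_def by (intro span_base) auto

lemma dj_circ_mem_dj_O1: "dj_circ V t s u v \<in> dj_O1 V t s"
  unfolding dj_O1_def by (intro span_base) auto

lemma derivative_homogeneous_mem_dj_O1:
  assumes "u \<in> weight_space V k"
  shows "Vir V (-1) u + smul V (of_int (k + int s - int t)) u \<in> dj_O1 V t s"
  using derivative_mem_dj_O1[of u s t]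
  by (simp add: Vir_0_homogeneous[OF assms] scale_left_distrib[symmetric] add_diff_eq)

text \<open>The induction hypothesis is applied to \<open>u\<close> and to \<open>L(-1)u\<close>, of
  weight \<open>k + 1\<close>. The residue of the latter with exponents \<open>a + 1\<close>,
  \<open>b\<close> equals \<open>b R a (b+1) + (b-a-1) R a b\<close>, and \<open>b > 0\<close>
  allows solving for the residue with the higher pole.\<close>

lemma residue_high_pole_mem_dj_O1:
  assumes "u \<in> weight_space V k"
  shows "residue V (k + int s) (int t + int s + 2 + int l) u v \<in> dj_O1 V t s"
  using assms
proof (induction l arbitrary: k u)
  case 0
  then show ?case using dj_circ_mem_dj_O1[of t s u v] by (simp add: dj_circ_homogeneous)
next
  case (Suc l)
  define a b where "a = k + int s" and "b = int t + int s + 2 + int l"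
  let ?O = "dj_O1 V t s"
  have 1: "residue V (a + 1) b (Vir V (-1) u) v \<in> ?O"
    using Suc.IH[OF weight_space_derivative[OF Suc.prems]]
    by (simp add: a_def b_def add_ac)
  have 2: "residue V a b u v \<in> ?O"
    using Suc.IH[OF Suc.prems] by (simp add: a_def b_def)
  have "residue V (a + 1) b (Vir V (-1) u) v = smul V (of_int b) (residue V a (b + 1) u v)
      + smul V (of_int b - of_int (a + 1)) (residue V a b u v)"
    using residue_exponent_Suc[of a "b + 1" u v]
    by (simp add: residue_derivative scale_right_distrib scale_left_diff_distrib)
  then have "smul V (of_int b) (residue V a (b + 1) u v) =
      residue V (a + 1) b (Vir V (-1) u) v
      - smul V (of_int b - of_int (a + 1)) (residue V a b u v)"
    by simp
  also have "\<dots> \<in> ?O"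
    by (intro subspace_diff subspace_scale subspace_dj_O1 1 2)
  finally have "residue V a (b + 1) u v \<in> ?O"
    by (rule subspace_scale_cancel[OF subspace_dj_O1, rotated]) (unfold of_int_eq_0_iff, simp add: b_def)
  then show ?case by (simp add: a_def b_def add_ac)
qed

text \<open>Each extra factor \<open>1 + z\<close> splits the residue into two whose pole orders
  differ by one; both stay in range because the pole order grows along with
  \<open>j\<close>.\<close>

lemma residue_mem_dj_O1:
  assumes "u \<in> weight_space V k"
  shows "residue V (k + int s + int j) (int t + int s + 2 + int j + int l) u v \<in> dj_O1 V t s"
proof (induction j arbitrary: l)
  case 0
  then show ?case using residue_high_pole_mem_dj_O1[OF assms] by simp
next
  case (Suc j)
  have "residue V (k + int s + int (Suc j)) (int t + int s + 2 + int (Suc j) + int l) u v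
      = residue V (k + int s + int j) (int t + int s + 2 + int j + int (Suc l)) u v
        + residue V (k + int s + int j) (int t + int s + 2 + int j + int l) u v"
    using residue_exponent_Suc[of "k + int s + int j"
        "int t + int s + 2 + int (Suc j) + int l" u v]
    by (simp add: add_ac)
  then show ?case using Suc by (simp only: subspace_add[OF subspace_dj_O1])
qed

lemma dj_circ_mem_dj_O1_le:
  assumes "s \<le> n" "t \<le> n"
  shows "dj_circ V n n u v \<in> dj_O1 V t s"
proof (induction u rule: homogeneous_induct)
  case (homogeneous k u)
  \<comment> \<open>The surplus of \<open>n\<close> over \<open>s\<close> goes into the exponent of
    \<open>1 + z\<close>; the pole order \<open>2n + 2\<close> pays for both surpluses.\<close>
  obtain j l where "n = s + j" "n = t + l" using assms[unfolded le_iff_add] by blast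
  then have "k + int n = k + int s + int j"
    "int n + int n + 2 = int t + int s + 2 + int j + int l"
    by linarith+
  with residue_mem_dj_O1[OF homogeneous, of s j t l v] show ?case
    by (simp only: dj_circ_homogeneous[OF homogeneous])
next
  case (add x y)
  then show ?case
    by (simp add: module_hom.add[OF linear_map_dj_circ_left] subspace_add[OF subspace_dj_O1])
qed

lemma bold_O_subset_dj_O1:
  assumes "s \<le> n" "t \<le> n"
  shows "bold_O V n \<subseteq> dj_O1 V t s"
  unfolding bold_O_def circ_n_eq_dj_circ
  by (rule span_minimal) (use dj_circ_mem_dj_O1_le[OF assms] subspace_dj_O1 in auto)

lemma zhu_O_antimono:
  assumes "t \<le> n"
  shows "zhu_O V n \<subseteq> zhu_O V t"
  unfolding zhu_O_def[of V n] circ_n_eq_dj_circ zhu_O_eq_dj_O1[of t]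
  by (rule span_minimal)
    (use dj_circ_mem_dj_O1_le[OF assms assms] derivative_mem_dj_O1[of _ t t]
      subspace_dj_O1 in auto)

subsection \<open>Comparison of the left actions\<close>

text \<open>Upper negation of the binomials. In this form \<open>t\<close> enters only as the
  truncation bound of the sum, so changing \<open>t\<close> merely adds or drops terms.\<close>

lemma dj_star_upper_homogeneous:
  assumes "u \<in> weight_space V k"
  shows "dj_star V t s t u v = (\<Sum>i = 0..t.
      smul V ((of_int (- int s - 1) :: complex) gchoose i)
        (residue V (k + int s) (int s + int i + 1) u v))"
proof -
  have "(of_int (- int s - 1) :: complex) gchoose i
      = (-1) ^ i * ibinom (int s + int t - int t + int i) i" for i
    by (subst gbinomial_negated_upper) (simp add: add.commute)
  then show ?thesis
    by (simp only: dj_star_homogeneous[OF assms]) simp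
qed

text \<open>
  The residue form of the identity
  \<open>(1 + z)\<^sup>s\<^sup>+\<^sup>1 (\<Sum>i\<le>t. binom (-s-1) i z\<^sup>-\<^sup>s\<^sup>-\<^sup>i\<^sup>-\<^sup>1) =
    1 + (-1)\<^sup>t (\<Sum>i\<le>s. binom (i+t) t (1 + z)\<^sup>i z\<^sup>-\<^sup>t\<^sup>-\<^sup>i\<^sup>-\<^sup>1)\<close>,
  which follows by lowering \<open>s\<close> with Pascal's rule.
\<close>

lemma dj_star_upper_expansion:
  assumes "u \<in> weight_space V k"
  shows "dj_star V t s t u v = residue V (k - 1) 0 u v + (\<Sum>i = 0..s.
      smul V ((-1) ^ t * of_nat ((i + t) choose t))
        (residue V (k + int i - 1) (int t + int i + 1) u v))"
proof -
  \<comment> \<open>\<open>T\<close> replaces \<open>s + 1\<close> by a variable \<open>q\<close>: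
    \<open>T (s + 1)\<close> is the product itself, while in \<open>T 0\<close> the binomials with
    upper entry 0 leave only the term \<open>R (k-1) 0\<close>.\<close>
  define T where "T q = (\<Sum>i = 0..t. smul V (ibinom (- q) i) (residue V (k + q - 1) (q + int i) u v))"
    for q :: int
  \<comment> \<open>Pascal's rule recombines neighbouring terms to upper entry \<open>- q\<close>;
    the truncation at \<open>t\<close> leaves exactly one boundary term, which becomes the summand
    of index \<open>s\<close> in the expansion.\<close>
  have telescope: "(\<Sum>i = 0..t. smul V (ibinom (- (q + 1)) i) (r (int i))
        + smul V (ibinom (- (q + 1)) i) (r (int i - 1)))
      = (\<Sum>i = 0..t. smul V (ibinom (- q) i) (r (int i - 1)))
        + smul V (ibinom (- (q + 1)) t) (r (int t))"
    for q :: int and r and t :: nat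
  proof (induction t)
    case (Suc t)
    have "ibinom (- q) (Suc t) = ibinom (- (q + 1)) t + ibinom (- (q + 1)) (Suc t)"
      using gbinomial_Suc_Suc[of "of_int (- (q + 1)) :: complex" t] by simp
    moreover have "int (Suc t) - 1 = int t" by simp
    ultimately show ?case
      by (simp only: sum.atLeast0_atMost_Suc Suc.IH scale_left_distrib) (simp only: add_ac)
  qed simp
  have step: "T (int s + 1) = T (int s) + smul V ((-1) ^ t * of_nat ((s + t) choose t))
      (residue V (k + int s - 1) (int t + int s + 1) u v)" for s
  proof -
    define r where "r j = residue V (k + int s - 1) (int s + 1 + j) u v" for j
    have "residue V (k + (int s + 1) - 1) (int s + 1 + int i) u v = r (int i) + r (int i - 1)" for i
      using residue_exponent_Suc[of "k + int s - 1" "int s + 1 + int i" u v]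
      by (simp add: r_def add_diff_eq)
    then have "T (int s + 1) = (\<Sum>i = 0..t. smul V (ibinom (- (int s + 1)) i) (r (int i))
        + smul V (ibinom (- (int s + 1)) i) (r (int i - 1)))"
      by (simp only: T_def scale_right_distrib)
    also have "\<dots> = (\<Sum>i = 0..t. smul V (ibinom (- int s) i) (r (int i - 1)))
        + smul V (ibinom (- (int s + 1)) t) (r (int t))"
      by (rule telescope)
    also have "(\<Sum>i = 0..t. smul V (ibinom (- int s) i) (r (int i - 1))) = T (int s)"
      by (simp add: T_def r_def)
    also have "r (int t) = residue V (k + int s - 1) (int t + int s + 1) u v"
      by (simp add: r_def add_ac)
    also have "ibinom (- (int s + 1)) t = (-1) ^ t * of_nat ((s + t) choose t)"
      by (subst gbinomial_negated_upper) (simp add: binomial_gbinomial add.commute)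
    finally show ?thesis .
  qed
  have "T (int s + 1) = T 0 + (\<Sum>i = 0..s. smul V ((-1) ^ t * of_nat ((i + t) choose t))
        (residue V (k + int i - 1) (int t + int i + 1) u v))"
  proof (induction s)
    case 0
    then show ?case using step[of 0] by simp
  next
    case (Suc s)
    have "T (int (Suc s) + 1) = T (int s + 1) + smul V ((-1) ^ t * of_nat ((Suc s + t) choose t))
      (residue V (k + int (Suc s) - 1) (int t + int (Suc s) + 1) u v)"
      using step[of "Suc s"] by (simp only: of_nat_Suc add.commute)
    then show ?case by (simp only: Suc.IH sum.atLeast0_atMost_Suc add.assoc)
  qed
  moreover have "dj_star V t s t u v = T (int s + 1)"
  proof -
    have "- (int s + 1) = - int s - 1" "k + (int s + 1) - 1 = k + int s"
      "int s + 1 + int i = int s + int i + 1" for i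
      by simp_all
    then show ?thesis by (simp only: dj_star_upper_homogeneous[OF assms] T_def)
  qed
  moreover have "T 0 = (\<Sum>i = 0..t. if i = 0 then residue V (k - 1) 0 u v else 0)"
    unfolding T_def by (rule sum.cong) (auto simp: gbinomial_0_left)
  ultimately show ?thesis by simp
qed

text \<open>The expansion for \<open>s = t = n\<close> consists of \<open>R (k-1) 0\<close> and
  precisely the sum that defines the right action.\<close>

lemma right_star_n_eq:
  assumes "u \<in> weight_space V k"
  shows "right_star_n V n w u = star_n V n u w - residue V (k - 1) 0 u w"
  by (simp add: star_n_eq_dj_star dj_star_upper_expansion[OF assms]
      right_star_n_homogeneous[OF assms])

text \<open>The two indices are lowered one at a time, through \<open>dj_star V n s n\<close>. The
  expansion compares \<open>n\<close> with \<open>s\<close> and the truncated form compares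
  \<open>n\<close> with \<open>t\<close>; the dropped terms have \<open>i > s\<close> and
  \<open>i > t\<close> respectively, hence poles high enough to lie in
  \<open>dj_O1 V t s\<close>.\<close>

lemma star_n_cong_dj_star:
  assumes "s \<le> n" "t \<le> n"
  shows "star_n V n u v - dj_star V t s t u v \<in> dj_O1 V t s"
proof (induction u rule: homogeneous_induct)
  case (homogeneous k u)
  let ?O = "dj_O1 V t s"
  let ?r = "\<lambda>i. smul V ((-1) ^ n * of_nat ((i + n) choose n))
        (residue V (k + int i - 1) (int n + int i + 1) u v)"
  have "dj_star V n n n u v - dj_star V n s n u v = sum ?r {0..n} - sum ?r {0..s}"
    by (simp add: dj_star_upper_expansion[OF homogeneous])
  also have "\<dots> = sum ?r ({0..n} - {0..s})"
    by (rule sum_diff[symmetric]) (use assms in auto)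
  also have "\<dots> \<in> ?O"
  proof (rule subspace_sum[OF subspace_dj_O1], rule subspace_scale[OF subspace_dj_O1])
    fix i assume "i \<in> {0..n} - {0..s}"
    then obtain j where i: "i = Suc s + j" by (auto simp: not_le less_iff_Suc_add)
    obtain l where "n = t + l" using assms le_iff_add by blast
    then have eqs: "k + int i - 1 = k + int s + int j"
      "int n + int i + 1 = int t + int s + 2 + int j + int l"
      unfolding i by simp_all
    show "residue V (k + int i - 1) (int n + int i + 1) u v \<in> ?O"
      unfolding eqs by (rule residue_mem_dj_O1[OF homogeneous])
  qed
  finally have 1: "dj_star V n n n u v - dj_star V n s n u v \<in> ?O" .
  let ?q = "\<lambda>i. smul V ((of_int (- int s - 1) :: complex) gchoose i)
        (residue V (k + int s) (int s + int i + 1) u v)"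
  have "dj_star V n s n u v - dj_star V t s t u v = sum ?q {0..n} - sum ?q {0..t}"
    by (simp only: dj_star_upper_homogeneous[OF homogeneous])
  also have "\<dots> = sum ?q ({0..n} - {0..t})"
    by (rule sum_diff[symmetric]) (use assms in auto)
  also have "\<dots> \<in> ?O"
  proof (rule subspace_sum[OF subspace_dj_O1], rule subspace_scale[OF subspace_dj_O1])
    fix i assume "i \<in> {0..n} - {0..t}"
    then obtain l where i: "i = Suc t + l" by (auto simp: not_le less_iff_Suc_add)
    have eq: "int s + int i + 1 = int t + int s + 2 + int l" unfolding i by simp
    show "residue V (k + int s) (int s + int i + 1) u v \<in> ?O"
      unfolding eq by (rule residue_high_pole_mem_dj_O1[OF homogeneous])
  qed
  finally have "dj_star V n s n u v - dj_star V t s t u v \<in> ?O" .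
  from subspace_add[OF subspace_dj_O1 1 this] show ?case by (simp add: star_n_eq_dj_star)
next
  case (add x y)
  from subspace_add[OF subspace_dj_O1 this] show ?case
    by (simp add: star_n_eq_dj_star module_hom.add[OF linear_map_dj_star_left] add_diff_add)
qed

subsection \<open>Skew symmetry and the right actions\<close>

text \<open>The vector \<open>x_(-i-1) 1\<close> is \<open>L(-1)^i x / i!\<close>. Modulo
  \<open>dj_O1 V t s\<close> the operator \<open>L(-1)\<close> acts on weight \<open>k\<close> as
  the scalar \<open>t - s - k\<close>, which drops by one with each application, so a binomial
  coefficient results.\<close>

lemma mode_vacuum_cong:
  assumes "x \<in> weight_space V k"
  shows "mode V x (- int i - 1) (vacuum V) - smul V (ibinom (int t - int s - k) i) x
    \<in> dj_O1 V t s"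
  using assms
proof (induction i arbitrary: k x)
  case 0
  then show ?case
    by (simp add: creation subspace_0[OF subspace_dj_O1])
next
  case (Suc i)
  let ?O = "dj_O1 V t s"
  let ?y = "Vir V (-1) x"
  define a where "a = int t - int s - k"
  have A: "mode V ?y (- int i - 1) (vacuum V) - smul V (ibinom (a - 1) i) ?y \<in> ?O"
  proof -
    have "int t - int s - (k + 1) = a - 1" by (simp add: a_def)
    with Suc.IH[OF weight_space_derivative[OF Suc.prems]] show ?thesis
      by (simp only: of_int_diff of_int_1)
  qed
  have B: "?y - smul V (of_int a) x \<in> ?O"
    using derivative_homogeneous_mem_dj_O1[OF Suc.prems, of s t]
    by (simp add: a_def scale_left_diff_distrib scale_left_distrib diff_diff_eq2 algebra_simps)
  have "mode V ?y (- int i - 1) (vacuum V)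
      = smul V (of_nat (Suc i)) (mode V x (- int (Suc i) - 1) (vacuum V))"
    by (simp add: derivative add.commute)
  moreover have "of_int a * ibinom (a - 1) i = of_nat (Suc i) * ibinom a (Suc i)"
    using gbinomial_absorption[of i "of_int a :: complex"] by simp
  ultimately have "(mode V ?y (- int i - 1) (vacuum V) - smul V (ibinom (a - 1) i) ?y)
      + smul V (ibinom (a - 1) i) (?y - smul V (of_int a) x)
      = smul V (of_nat (Suc i)) (mode V x (- int (Suc i) - 1) (vacuum V)
        - smul V (ibinom a (Suc i)) x)"
    by (simp only: scale_right_diff_distrib scale_scale mult.commute) simp
  moreover have "\<dots> \<in> ?O"
    unfolding calculation[symmetric]
    by (intro subspace_add subspace_scale subspace_dj_O1 A B)
  ultimately have "smul V (of_nat (Suc i))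
      (mode V x (- int (Suc i) - 1) (vacuum V) - smul V (ibinom a (Suc i)) x) \<in> ?O"
    by (simp only:)
  then have "mode V x (- int (Suc i) - 1) (vacuum V) - smul V (ibinom a (Suc i)) x \<in> ?O"
    by (rule subspace_scale_cancel[OF subspace_dj_O1, rotated]) (simp del: of_nat_Suc)
  then show ?case by (simp only: a_def)
qed

text \<open>In modes this is \<open>Y(w,z)b = exp(z L(-1)) Y(b,-z)w\<close>, with
  \<open>L(-1)^j / j!\<close> written as a mode applied to the vacuum. It is the Borcherds identity
  at \<open>-1\<close>, \<open>m\<close>, \<open>0\<close> with the vacuum as third vector: by the
  creation property the first sum on the right vanishes and the second keeps only its term of index
  0.\<close>

lemma mode_skew_symmetry:
  assumes "\<And>m'. m' \<ge> m + int M \<Longrightarrow> mode V b m' w = 0"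
  shows "mode V w m b = (\<Sum>j<M. smul V (- ((-1) powi m) * (-1) ^ j)
    (mode V (mode V b (m + int j) w) (- int j - 1) (vacuum V)))"
proof -
  let ?g = "\<lambda>j. mode V (mode V b (m + int j) w) (- int j - 1) (vacuum V)"
  have zero: "mode V 0 n x = 0" "mode V x n 0 = 0" for n x
    by (rule module_hom.zero[OF linear_map_mode_left] module_hom.zero[OF linear_map_mode_right])+
  have minus1: "ibinom (-1) j = (-1) ^ j" for j
    using gbinomial_minus[of "1::complex" j] gbinomial_of_nat_symmetric[of j j, where 'a = complex]
    by simp
  have "Sum_any (\<lambda>i::nat. smul V (ibinom (-1) i)
        (mode V (mode V b (m + int i) w) (-1 + 0 - int i) (vacuum V)))
      = (\<Sum>j<M. smul V (ibinom (-1) j)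
        (mode V (mode V b (m + int j) w) (-1 + 0 - int j) (vacuum V)))"
  proof (rule Sum_any.expand_superset)
    show "{i. smul V (ibinom (-1) i)
        (mode V (mode V b (m + int i) w) (-1 + 0 - int i) (vacuum V)) \<noteq> 0} \<subseteq> {..<M}"
    proof
      fix i assume "i \<in> {i. smul V (ibinom (-1) i)
        (mode V (mode V b (m + int i) w) (-1 + 0 - int i) (vacuum V)) \<noteq> 0}"
      then show "i \<in> {..<M}"
        using assms[of "m + int i"] by (cases "i < M") (auto simp: zero)
    qed
  qed simp
  moreover have "Sum_any (\<lambda>i::nat. smul V ((-1) ^ i * ibinom m i)
        (mode V b (-1 + m - int i) (mode V w (0 + int i) (vacuum V)))) = 0"
    by (simp add: creation zero)
  moreover have "Sum_any (\<lambda>i::nat. smul V ((-1) ^ i * ibinom m i * (-1) powi m)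
        (mode V w (0 + m - int i) (mode V b (-1 + int i) (vacuum V))))
      = (\<Sum>i\<in>{0::nat}. smul V ((-1) ^ i * ibinom m i * (-1) powi m)
        (mode V w (0 + m - int i) (mode V b (-1 + int i) (vacuum V))))"
  proof (rule Sum_any.expand_superset)
    show "{i::nat. smul V ((-1) ^ i * ibinom m i * (-1) powi m)
        (mode V w (0 + m - int i) (mode V b (-1 + int i) (vacuum V))) \<noteq> 0} \<subseteq> {0}"
    proof
      fix i :: nat
      assume "i \<in> {i. smul V ((-1) ^ i * ibinom m i * (-1) powi m)
        (mode V w (0 + m - int i) (mode V b (-1 + int i) (vacuum V))) \<noteq> 0}"
      then show "i \<in> {0}"
        by (cases i) (auto simp: creation zero)
    qed
  qed simp
  ultimately have "(\<Sum>j<M. smul V (ibinom (-1) j)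
        (mode V (mode V b (m + int j) w) (-1 + 0 - int j) (vacuum V)))
      = - smul V ((-1) powi m) (mode V w m b)"
    using borcherds[of "-1" b m w 0 "vacuum V"] by (simp add: creation)
  moreover have "-1 + 0 - int j = - int j - 1" for j by simp
  ultimately have "(\<Sum>j<M. smul V ((-1) ^ j) (?g j)) = - smul V ((-1) powi m) (mode V w m b)"
    by (simp only: minus1)
  then have "smul V (- ((-1) powi m)) (\<Sum>j<M. smul V ((-1) ^ j) (?g j))
      = smul V ((-1) powi m * (-1) powi m) (mode V w m b)"
    by simp
  moreover have "(-1) powi m * (-1) powi m = (1::complex)"
    by (simp flip: power_int_mult_distrib)
  ultimately show ?thesis
    by (simp add: scale_sum_right)
qed

lemma mode_skew_cong:
  assumes "w \<in> weight_space V l" "b \<in> weight_space V k"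
    and "\<And>m'. m' \<ge> m + int M \<Longrightarrow> mode V b m' w = 0"
  shows "mode V w m b - (\<Sum>j<M. smul V (- ((-1) powi m) * (-1) ^ j *
      ibinom (int t - int s - k - l + m + int j + 1) j) (mode V b (m + int j) w)) \<in> dj_O1 V t s"
proof -
  let ?c = "\<lambda>j. - ((-1) powi m) * (-1) ^ j"
  let ?e = "\<lambda>j. ibinom (int t - int s - k - l + m + int j + 1) j"
  have "mode V w m b - (\<Sum>j<M. smul V (?c j * ?e j) (mode V b (m + int j) w))
      = (\<Sum>j<M. smul V (?c j) (mode V (mode V b (m + int j) w) (- int j - 1) (vacuum V)
        - smul V (?e j) (mode V b (m + int j) w)))"
    by (simp only: mode_skew_symmetry[OF assms(3)] scale_right_diff_distrib sum_subtractf scale_scale)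
  also have "\<dots> \<in> dj_O1 V t s"
  proof (intro subspace_sum[OF subspace_dj_O1] subspace_scale[OF subspace_dj_O1])
    fix j
    \<comment> \<open>The vector \<open>b_(m+j) w\<close> has weight
      \<open>k + l - (m + j) - 1\<close>, which fixes the upper entry of the binomial.\<close>
    have "int t - int s - (k + l - (m + int j) - 1)
        = int t - int s - k - l + m + int j + 1"
      by simp
    then show "mode V (mode V b (m + int j) w) (- int j - 1) (vacuum V)
        - smul V (?e j) (mode V b (m + int j) w) \<in> dj_O1 V t s"
      using mode_vacuum_cong[OF weight_space_mode[OF assms(2,1)], of "m + int j" j t s]
      by (simp only:)
  qed
  finally show ?thesis .
qed

text \<open>
  Modulo \<open>L(-1) + L(0) + s - t\<close> the operator \<open>exp (z L(-1))\<close> is \<open>(1 + z)\<^sup>t\<^sup>-\<^sup>s\<^sup>-\<^sup>L\<^sup>(\<^sup>0\<^sup>)\<close>, so skew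
  symmetry followed by the substitution \<open>z \<mapsto> -z/(1 + z)\<close> exchanges the two arguments; on
  coefficients the substitution is the Vandermonde convolution.
\<close>

lemma residue_skew_cong:
  assumes "w \<in> weight_space V l" "b \<in> weight_space V k"
  shows "residue V (l + int s) (int c) w b
      - smul V ((-1) ^ (c + 1)) (residue V (k + int c - int t - 2) (int c) b w) \<in> dj_O1 V t s"
proof -
  let ?O = "dj_O1 V t s"
  obtain M1 M2 :: nat where M1: "\<forall>m\<ge>int M1 - int c. mode V w m b = 0"
    and M2: "\<forall>m\<ge>int M2 - int c. mode V b m w = 0"
    using mode_eventually_zero by metis
  define M where "M = max M1 M2"
  have wb: "\<And>m. m \<ge> int M - int c \<Longrightarrow> mode V w m b = 0"
    and bw: "\<And>m. m \<ge> int M - int c \<Longrightarrow> mode V b m w = 0"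
    using M1 M2 by (simp_all add: M_def)
  \<comment> \<open>The upper entry of the binomial depends on \<open>i\<close> and \<open>j\<close>
    only through \<open>r = i + j\<close>. After summing along \<open>i + j = r\<close> it is
    constant, so Vandermonde applies.\<close>
  define A where "A r = int t - int s - k - l + int r - int c + 1" for r
  define g where "g i j = smul V ((-1) ^ (c + 1) * (-1) ^ (i + j) *
      (ibinom (l + int s) i * ibinom (A (i + j)) j)) (mode V b (int (i + j) - int c) w)" for i j
  have inner: "smul V (ibinom (l + int s) i) (mode V w (int i - int c) b) - (\<Sum>j<M - i. g i j) \<in> ?O"
    if "i < M" for i
  proof -
    let ?S = "\<Sum>j<M - i. smul V (- ((-1) powi (int i - int c)) * (-1) ^ j *
      ibinom (int t - int s - k - l + (int i - int c) + int j + 1) j)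
        (mode V b (int i - int c + int j) w)"
    have "mode V w (int i - int c) b - ?S \<in> ?O"
      by (rule mode_skew_cong[OF assms]) (use that in \<open>auto intro: bw\<close>)
    then have "smul V (ibinom (l + int s) i) (mode V w (int i - int c) b - ?S) \<in> ?O"
      by (rule subspace_scale[OF subspace_dj_O1])
    moreover have "smul V (ibinom (l + int s) i) ?S = (\<Sum>j<M - i. g i j)"
      unfolding scale_sum_right scale_scale g_def
    proof (rule sum.cong[OF refl])
      fix j
      have "(-1) powi (int i - int c) = ((-1) ^ c * (-1) ^ i :: complex)"
        by (simp add: power_int_diff minus_one_power_iff)
      then have "ibinom (l + int s) i * (- ((-1) powi (int i - int c)) * (-1) ^ j * e)
          = (-1) ^ (c + 1) * (-1) ^ (i + j) * (ibinom (l + int s) i * e)" for e :: complex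
        by (simp add: power_add)
      moreover have "int t - int s - k - l + (int i - int c) + int j + 1 = A (i + j)"
        "int i - int c + int j = int (i + j) - int c"
        by (simp_all add: A_def)
      ultimately show "smul V (ibinom (l + int s) i * (- ((-1) powi (int i - int c)) * (-1) ^ j *
          ibinom (int t - int s - k - l + (int i - int c) + int j + 1) j))
          (mode V b (int i - int c + int j) w)
        = smul V ((-1) ^ (c + 1) * (-1) ^ (i + j) * (ibinom (l + int s) i * ibinom (A (i + j)) j))
          (mode V b (int (i + j) - int c) w)"
        by (simp only:)
    qed
    ultimately show ?thesis by (simp only: scale_right_diff_distrib)
  qed
  have "(\<Sum>i<M. \<Sum>j<M - i. g i j) = (\<Sum>(i, j)\<in>{(i, j). i + j < M}. g i j)"
    by (subst sum.Sigma) (auto intro!: sum.cong)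
  also have "\<dots> = (\<Sum>r<M. \<Sum>i\<le>r. g i (r - i))"
    by (rule sum.triangle_reindex)
  also have "\<dots> = (\<Sum>r<M. smul V ((-1) ^ (c + 1)) (smul V (ibinom (k + int c - int t - 2) r)
      (mode V b (int r - int c) w)))"
  proof (rule sum.cong[OF refl])
    fix r
    have "(\<Sum>i\<le>r. g i (r - i)) = (\<Sum>i\<le>r. smul V ((-1) ^ (c + 1) * (-1) ^ r *
        (ibinom (l + int s) i * ibinom (A r) (r - i))) (mode V b (int r - int c) w))"
      by (rule sum.cong) (auto simp: g_def)
    also have "\<dots> = smul V ((-1) ^ (c + 1) * (-1) ^ r *
        (\<Sum>i\<le>r. ibinom (l + int s) i * ibinom (A r) (r - i))) (mode V b (int r - int c) w)"
      by (simp only: scale_sum_left sum_distrib_left)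
    also have "(\<Sum>i\<le>r. ibinom (l + int s) i * ibinom (A r) (r - i)) = ibinom (l + int s + A r) r"
      by (simp add: gbinomial_Vandermonde atLeast0AtMost[symmetric])
    also have "l + int s + A r = int r - (k + int c - int t - 2) - 1"
      by (simp add: A_def)
    \<comment> \<open>Upper negation absorbs the sign \<open>(-1)^r\<close> left by the substitution
      \<open>z -> -z/(1+z)\<close>.\<close>
    also have "(-1) ^ (c + 1) * (-1) ^ r * ibinom (int r - (k + int c - int t - 2) - 1) r
        = (-1) ^ (c + 1) * ibinom (k + int c - int t - 2) r"
      by (subst (2) gbinomial_negated_upper) simp
    finally show "(\<Sum>i\<le>r. g i (r - i)) = smul V ((-1) ^ (c + 1))
        (smul V (ibinom (k + int c - int t - 2) r) (mode V b (int r - int c) w))"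
      by simp
  qed
  also have "\<dots> = smul V ((-1) ^ (c + 1)) (residue V (k + int c - int t - 2) (int c) b w)"
    by (simp only: residue_eq_sum[OF bw] scale_sum_right)
  finally have "residue V (l + int s) (int c) w b
      - smul V ((-1) ^ (c + 1)) (residue V (k + int c - int t - 2) (int c) b w)
      = (\<Sum>i<M. smul V (ibinom (l + int s) i) (mode V w (int i - int c) b) - (\<Sum>j<M - i. g i j))"
    by (simp only: residue_eq_sum[OF wb] sum_subtractf)
  also have "\<dots> \<in> ?O"
    by (rule subspace_sum[OF subspace_dj_O1]) (use inner in auto)
  finally show ?thesis .
qed

text \<open>Skew symmetry is applied term by term with \<open>c = t + i + 1\<close>. Then
  \<open>k + c - t - 2 = k + i - 1\<close> and the signs combine to \<open>(-1)^t\<close>, which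
  gives the sum in \<open>dj_star_upper_expansion\<close>.\<close>

lemma dj_star_lower_cong:
  assumes "b \<in> weight_space V k"
  shows "dj_star V t s s w b - (dj_star V t s t b w - residue V (k - 1) 0 b w) \<in> dj_O1 V t s"
proof (induction w rule: homogeneous_induct)
  case (homogeneous l w)
  let ?O = "dj_O1 V t s"
  let ?r = "\<lambda>i. residue V (l + int s) (int (t + i + 1)) w b"
  let ?q = "\<lambda>i. residue V (k + int (t + i + 1) - int t - 2) (int (t + i + 1)) b w"
  let ?e = "\<lambda>i. (-1) ^ i * ibinom (int (t + i)) i"
  have "dj_star V t s s w b = (\<Sum>i = 0..s. smul V (?e i) (?r i))"
    by (simp add: dj_star_homogeneous[OF homogeneous] add_ac)
  moreover have "dj_star V t s t b w - residue V (k - 1) 0 b w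
      = (\<Sum>i = 0..s. smul V (?e i) (smul V ((-1) ^ (t + i + 1 + 1)) (?q i)))"
  proof -
    have "(-1) ^ t * of_nat ((i + t) choose t) = ?e i * (-1) ^ (t + i + 1 + 1)"
      "k + int i - 1 = k + int (t + i + 1) - int t - 2"
      "int t + int i + 1 = int (t + i + 1)" for i
      using binomial_symmetric[of t "i + t"]
      by (simp_all add: binomial_gbinomial minus_one_power_iff add.commute)
    then show ?thesis
      by (simp only: dj_star_upper_expansion[OF assms] scale_scale) simp
  qed
  ultimately have "dj_star V t s s w b - (dj_star V t s t b w - residue V (k - 1) 0 b w)
      = (\<Sum>i = 0..s. smul V (?e i) (?r i - smul V ((-1) ^ (t + i + 1 + 1)) (?q i)))"
    by (simp only: scale_right_diff_distrib sum_subtractf)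
  also have "\<dots> \<in> ?O"
    by (intro subspace_sum[OF subspace_dj_O1] subspace_scale[OF subspace_dj_O1]
        residue_skew_cong[OF homogeneous assms])
  finally show ?case .
next
  case (add x y)
  from subspace_add[OF subspace_dj_O1 this] show ?case
    by (simp add: module_hom.add[OF linear_map_dj_star_left]
        module_hom.add[OF linear_map_dj_star_right] module_hom.add[OF linear_map_residue_right]
        add_diff_add)
qed

text \<open>Since \<open>Y(1,z)\<close> is the identity, the summand of index \<open>i\<close> reads
  off the coefficient of \<open>z^(s+i)\<close> in \<open>(1+z)^s\<close>, which is 1 for
  \<open>i = 0\<close> and 0 otherwise.\<close>

lemma dj_star_vacuum_left: "dj_star V t s t (vacuum V) v = v"
proof -
  have res: "residue V a b (vacuum V) v = (if b \<ge> 1 then smul V (ibinom a (nat (b - 1))) v else 0)"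
    for a b
  proof -
    have "residue V a b (vacuum V) v = Sum_any (\<lambda>i. if i = nat (b - 1) then
        (if b \<ge> 1 then smul V (ibinom a i) v else 0) else 0)"
      unfolding residue_def vacuum_mode by (rule Sum_any.cong) auto
    then show ?thesis by simp
  qed
  have "dj_star V t s t (vacuum V) v = (\<Sum>i = 0..t. if i = 0 then v else 0)"
    unfolding dj_star_upper_homogeneous[OF vacuum_weight] res
  proof (rule sum.cong[OF refl])
    fix i
    have "nat (int s + int i + 1 - 1) = s + i" by simp
    moreover have "ibinom (0 + int s) (s + i) = of_nat (s choose (s + i))"
      by (simp add: binomial_gbinomial)
    moreover have "s choose (s + i) = (if i = 0 then 1 else 0)"
      by (simp add: binomial_eq_0)
    ultimately show "smul V ((of_int (- int s - 1) :: complex) gchoose i)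
        (if 1 \<le> int s + int i + 1
         then smul V (ibinom (0 + int s) (nat (int s + int i + 1 - 1))) v else 0)
      = (if i = 0 then v else 0)"
      by (simp only:) simp
  qed
  then show ?thesis by simp
qed

lemma dj_star_vacuum_right: "dj_star V t s s w (vacuum V) - w \<in> dj_O1 V t s"
proof -
  have "residue V (0 - 1) 0 (vacuum V) w = 0"
    by (simp add: residue_def vacuum_mode)
  with dj_star_lower_cong[OF vacuum_weight, of t s w] show ?thesis
    by (simp add: dj_star_vacuum_left)
qed

text \<open>Both right actions are the corresponding left action minus the same
  \<open>R (k-1) 0\<close>, so the comparison of left actions carries over.\<close>

lemma right_star_n_cong_dj_star:
  assumes "s \<le> n" "t \<le> n"
  shows "right_star_n V n w u - dj_star V t s s w u \<in> dj_O1 V t s"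
proof (induction u rule: homogeneous_induct)
  case (homogeneous k u)
  from subspace_diff[OF subspace_dj_O1 star_n_cong_dj_star[OF assms, of u w]
      dj_star_lower_cong[OF homogeneous, of t s w]]
  show ?case by (simp add: right_star_n_eq[OF homogeneous] algebra_simps)
next
  case (add x y)
  from subspace_add[OF subspace_dj_O1 this] show ?case
    by (simp add: module_hom.add[OF linear_map_right_star_right]
        module_hom.add[OF linear_map_dj_star_right] add_diff_add)
qed

subsection \<open>Associativity\<close>

text \<open>Levels compose like arrows: \<open>dj_star V t s p\<close> pairs an arrow from
  \<open>p\<close> to \<open>t\<close> with one from \<open>s\<close> to \<open>p\<close>. Here
  \<open>a\<close> goes from \<open>q\<close> to \<open>t\<close>, \<open>b\<close> from
  \<open>p\<close> to \<open>q\<close> and \<open>c\<close> from \<open>s\<close> to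
  \<open>p\<close>.\<close>

definition associator :: "nat \<Rightarrow> nat \<Rightarrow> nat \<Rightarrow> nat \<Rightarrow> 'v \<Rightarrow> 'v \<Rightarrow> 'v \<Rightarrow> 'v" where
  "associator t s p q a b c =
     dj_star V t s p (dj_star V t p q a b) c - dj_star V t s q a (dj_star V q s p b c)"

lemma subspace_set_plus:
  assumes "subspace S" "subspace T"
  shows "subspace (S + T)"
proof -
  have "S + T = {x + y |x y. x \<in> S \<and> y \<in> T}" by (auto simp: set_plus_def)
  then show ?thesis using subspace_sums[OF assms] by simp
qed

lemma subspace_dj_O: "subspace (dj_O V t s)"
  unfolding dj_O_def dj_O1_def dj_O2_def dj_O3_def
  by (intro subspace_set_plus subspace_span)

lemma dj_O_supersets:
  "dj_O1 V t s \<subseteq> dj_O V t s" "dj_O2 V t s \<subseteq> dj_O V t s" "dj_O3 V t s \<subseteq> dj_O V t s"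
proof -
  have 0: "0 \<in> dj_O1 V t s" "0 \<in> dj_O2 V t s" "0 \<in> dj_O3 V t s"
    by (simp_all add: dj_O1_def dj_O2_def dj_O3_def span_zero)
  show "dj_O1 V t s \<subseteq> dj_O V t s" "dj_O2 V t s \<subseteq> dj_O V t s" "dj_O3 V t s \<subseteq> dj_O V t s"
    using set_plus_intro[OF set_plus_intro[OF _ 0(2)] 0(3)]
      set_plus_intro[OF set_plus_intro[OF 0(1)] 0(3)]
      set_plus_intro[OF set_plus_intro[OF 0(1,2)]]
    by (fastforce simp: dj_O_def)+
qed

lemma dj_star_associator_mem_dj_O:
  "dj_star V t s r u (associator r s p q a b c) \<in> dj_O V t s"
  unfolding associator_def
  by (rule subsetD[OF dj_O_supersets(2)], unfold dj_O2_def, rule span_base) blast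

text \<open>The outer factor of a generator of \<open>dj_O2\<close> is taken to be the vacuum, an
  exact left unit.\<close>

lemma associator_mem_dj_O: "associator t s p q a b c \<in> dj_O V t s"
  using dj_star_associator_mem_dj_O[of t s t "vacuum V" p q a b c]
  by (simp add: dj_star_vacuum_left)

lemma dj_star_dj_O1_dj_star_mem_dj_O:
  "x \<in> dj_O1 V q p \<Longrightarrow> dj_star V t s p (dj_star V t p q a x) b \<in> dj_O V t s"
  by (rule subsetD[OF dj_O_supersets(3)], unfold dj_O3_def, rule span_base) blast

lemma dj_O_generator_cases [consumes 3, case_names O1 O2 O3]:
  assumes "x \<in> dj_O V t s" "linear_map f" "subspace W"
    and "\<And>x. x \<in> dj_O1 V t s \<Longrightarrow> f x \<in> W"
    and "\<And>r u p q a b c. f (dj_star V t s r u (associator r s p q a b c)) \<in> W"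
    and "\<And>p q a y b. y \<in> dj_O1 V q p \<Longrightarrow> f (dj_star V t s p (dj_star V t p q a y) b) \<in> W"
  shows "f x \<in> W"
proof -
  obtain x1 x2 x3 where x: "x = x1 + x2 + x3"
    and mem: "x1 \<in> dj_O1 V t s" "x2 \<in> dj_O2 V t s" "x3 \<in> dj_O3 V t s"
    using assms(1) unfolding dj_O_def by (auto elim!: set_plus_elim)
  have "f x2 \<in> W"
    by (rule span_subset_linear_preimage[OF assms(2,3) _ mem(2)[unfolded dj_O2_def]])
      (use assms(5) in \<open>auto simp: associator_def\<close>)
  moreover have "f x3 \<in> W"
    by (rule span_subset_linear_preimage[OF assms(2,3) _ mem(3)[unfolded dj_O3_def]])
      (use assms(6) in auto)
  ultimately show ?thesis
    using assms(4)[OF mem(1)] by (simp add: x module_hom.add[OF assms(2)] subspace_add[OF assms(3)])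
qed

text \<open>Generators of \<open>dj_O3\<close> carry a factor on the right; the vacuum is put there.
  It is a right unit only modulo \<open>dj_O1\<close>, whence the correction term.\<close>

lemma dj_star_dj_O1_mem_dj_O:
  assumes "x \<in> dj_O1 V p s"
  shows "dj_star V t s p u x \<in> dj_O V t s"
proof -
  let ?y = "dj_star V t s p u x"
  have "dj_star V t s s ?y (vacuum V) - (dj_star V t s s ?y (vacuum V) - ?y) \<in> dj_O V t s"
    by (intro subspace_diff[OF subspace_dj_O] dj_star_dj_O1_dj_star_mem_dj_O[OF assms]
        subsetD[OF dj_O_supersets(1)] dj_star_vacuum_right)
  then show ?thesis by simp
qed

lemma dj_O1_dj_star_mem_dj_O:
  "x \<in> dj_O1 V t p \<Longrightarrow> dj_star V t s p x v \<in> dj_O V t s"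
  using dj_star_dj_O1_dj_star_mem_dj_O[of x t p t s "vacuum V" v]
  by (simp add: dj_star_vacuum_left)

text \<open>The subspaces \<open>dj_O\<close> form a left ideal for the composition of levels; this
  and the next lemma make the two actions independent of the representative in the module.\<close>

lemma dj_star_dj_O_mem_dj_O:
  assumes "x \<in> dj_O V p s"
  shows "dj_star V t s p u x \<in> dj_O V t s"
  using assms linear_map_dj_star_right[of t s p u] subspace_dj_O
proof (cases rule: dj_O_generator_cases)
  case (O1 x)
  then show "dj_star V t s p u x \<in> dj_O V t s" by (rule dj_star_dj_O1_mem_dj_O)
next
  case (O2 r u' p' q a b c)
  let ?X = "associator r s p' q a b c"
  \<comment> \<open>Reassociating merges \<open>u\<close> and \<open>u'\<close> into a single outer
    factor, so a generator of \<open>dj_O2\<close> appears again, up to an associator.\<close>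
  have "dj_star V t s p u (dj_star V p s r u' ?X)
      = dj_star V t s r (dj_star V t r p u u') ?X - associator t s r p u u' ?X"
    by (simp add: associator_def)
  also have "\<dots> \<in> dj_O V t s"
    by (intro subspace_diff[OF subspace_dj_O] dj_star_associator_mem_dj_O associator_mem_dj_O)
  finally show "dj_star V t s p u (dj_star V p s r u' ?X) \<in> dj_O V t s" .
next
  case (O3 p1 p2 a x b)
  \<comment> \<open>Three edges of the associativity pentagon: \<open>u((ax)b) ~ u(a(xb)) ~ (ua)(xb) ~ ((ua)x)b\<close>.\<close>
  let ?ua = "dj_star V t p2 p u a" and ?xb = "dj_star V p2 s p1 x b"
  have "dj_star V t s p u (dj_star V p s p1 (dj_star V p p1 p2 a x) b)
      = dj_star V t s p1 (dj_star V t p1 p2 ?ua x) b - associator t s p1 p2 ?ua x b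
        - associator t s p2 p u a ?xb + dj_star V t s p u (associator p s p1 p2 a x b)"
    by (simp add: associator_def module_hom.diff[OF linear_map_dj_star_right])
  also have "\<dots> \<in> dj_O V t s"
    by (intro subspace_add[OF subspace_dj_O] subspace_diff[OF subspace_dj_O]
        dj_star_dj_O1_dj_star_mem_dj_O[OF O3] dj_star_associator_mem_dj_O associator_mem_dj_O)
  finally show "dj_star V t s p u (dj_star V p s p1 (dj_star V p p1 p2 a x) b) \<in> dj_O V t s" .
qed

lemma dj_O_dj_star_mem_dj_O:
  assumes "x \<in> dj_O V t p"
  shows "dj_star V t s p x v \<in> dj_O V t s"
  using assms linear_map_dj_star_left[of t s p v] subspace_dj_O
proof (cases rule: dj_O_generator_cases)
  case (O1 x)
  then show "dj_star V t s p x v \<in> dj_O V t s" by (rule dj_O1_dj_star_mem_dj_O)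
next
  case (O2 r u p1 p2 a b c)
  let ?X = "associator r p p1 p2 a b c"
  let ?ab = "dj_star V r p1 p2 a b" and ?bc = "dj_star V p2 p p1 b c"
    and ?cv = "dj_star V p1 s p c v" and ?ua = "dj_star V t p2 r u a"
  let ?A = "associator p2 s p p1 b c v"
  \<comment> \<open>The pentagon identity for \<open>a\<close>, \<open>b\<close>, \<open>c\<close>,
    \<open>v\<close>: an associator times \<open>v\<close> is a combination of the other four
    edges.\<close>
  have "dj_star V r s p ?X v = associator r s p p1 ?ab c v + associator r s p1 p2 a b ?cv
      - associator r s p p2 a ?bc v - dj_star V r s p2 a ?A"
    by (simp add: associator_def module_hom.diff[OF linear_map_dj_star_right]
        module_hom.diff[OF linear_map_dj_star_left])
  \<comment> \<open>After multiplication by \<open>u\<close> the last edge becomes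
    \<open>u (a A)\<close>, with two outer factors; it is rewritten as \<open>(u a) A\<close> minus
    an associator.\<close>
  then have "dj_star V t s p (dj_star V t p r u ?X) v = associator t s p r u ?X v
      + (dj_star V t s r u (associator r s p p1 ?ab c v)
      + dj_star V t s r u (associator r s p1 p2 a b ?cv)
      - dj_star V t s r u (associator r s p p2 a ?bc v)
      - (dj_star V t s p2 ?ua ?A - associator t s p2 r u a ?A))"
    by (simp add: associator_def[of t] module_hom.diff[OF linear_map_dj_star_right]
        module_hom.add[OF linear_map_dj_star_right])
  also have "\<dots> \<in> dj_O V t s"
    by (intro subspace_add[OF subspace_dj_O] subspace_diff[OF subspace_dj_O]
        dj_star_associator_mem_dj_O associator_mem_dj_O)
  finally show "dj_star V t s p (dj_star V t p r u ?X) v \<in> dj_O V t s" .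
next
  case (O3 p1 p2 a x b)
  \<comment> \<open>Up to an associator, \<open>((a x) b) v\<close> is \<open>(a x) (b v)\<close>,
    again of the form that generates \<open>dj_O3\<close>.\<close>
  have "dj_star V t s p (dj_star V t p p1 (dj_star V t p1 p2 a x) b) v
      = associator t s p p1 (dj_star V t p1 p2 a x) b v
        + dj_star V t s p1 (dj_star V t p1 p2 a x) (dj_star V p1 s p b v)"
    by (simp add: associator_def)
  also have "\<dots> \<in> dj_O V t s"
    by (intro subspace_add[OF subspace_dj_O] associator_mem_dj_O
        dj_star_dj_O1_dj_star_mem_dj_O[OF O3])
  finally show "dj_star V t s p (dj_star V t p p1 (dj_star V t p1 p2 a x) b) v \<in> dj_O V t s" .
qed

subsection \<open>Cosets\<close>

lemma coset_eqI:
  assumes "subspace W" "x - y \<in> W"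
  shows "x +o W = y +o W"
proof -
  have "x +o W \<subseteq> y +o W" if "x - y \<in> W" for x y
  proof
    fix z assume "z \<in> x +o W"
    then have "(z - x) + (x - y) \<in> W"
      by (intro subspace_add[OF assms(1)] that set_plus_imp_minus)
    then show "z \<in> y +o W" by (simp add: set_minus_plus[symmetric])
  qed
  from this[OF assms(2)] this[of y x] subspace_neg[OF assms] show ?thesis by auto
qed

text \<open>All members of the union are the same coset. \<open>P\<close> and \<open>Q\<close> are
  separate because algebra and module are quotients by different subspaces; the vector
  \<open>c\<close> is free, so that two different products can be evaluated to one common
  coset.\<close>

lemma induced_op_coset:
  assumes "subspace W" "0 \<in> P" "0 \<in> Q"
    and "\<And>x y. x \<in> P \<Longrightarrow> y \<in> Q \<Longrightarrow> f (a + x) (b + y) - c \<in> W"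
  shows "induced_op f W (a +o P) (b +o Q) = c +o W"
proof -
  have eq: "f a' b' +o W = c +o W" if "a' \<in> a +o P" "b' \<in> b +o Q" for a' b'
    using that assms(4) by (intro coset_eqI[OF assms(1)]) (auto simp: elt_set_plus_def)
  have "a \<in> a +o P" "b \<in> b +o Q"
    using assms(2,3) by (force simp: elt_set_plus_def)+
  then show ?thesis unfolding induced_op_def using eq by blast
qed

lemma subspace_absorb:
  assumes "subspace W" "0 \<in> U" "U \<subseteq> W"
  shows "U + W = W"
proof
  show "U + W \<subseteq> W" using assms(1,3) by (auto elim!: set_plus_elim intro: subspace_add)
  show "W \<subseteq> U + W" using assms(2) by (rule set_zero_plus2)
qed

lemma quotient_map_coset:
  assumes "subspace W" "0 \<in> U" "U \<subseteq> W"
  shows "quotient_map W (a +o U) = a +o W"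
  by (simp add: quotient_map_def set_plus_rearrange3 subspace_absorb[OF assms])

text \<open>Adding \<open>W\<close> commutes with the unions. Evaluation on cosets can thus be
  carried out modulo \<open>W\<close>, where independence of representatives has been
  proved.\<close>

lemma quotient_map_induced_op:
  assumes "subspace W" "0 \<in> U" "U \<subseteq> W"
  shows "quotient_map W (induced_op f U X Z) = induced_op f W X Z"
proof -
  have "quotient_map W (induced_op f U X Z) = (\<Union>a\<in>X. \<Union>b\<in>Z. quotient_map W (f a b +o U))"
    unfolding quotient_map_def induced_op_def by (auto simp: set_plus_def)
  then show ?thesis by (simp add: quotient_map_coset[OF assms] induced_op_def)
qed

lemma star_n_coset:
  assumes "s \<le> n" "t \<le> n" "a' - a \<in> zhu_O V t" "w' - w \<in> dj_O V t s"
  shows "dj_star V t s t a' w' - dj_star V t s t a w \<in> dj_O V t s"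
    and "star_n V n a' w' - dj_star V t s t a w \<in> dj_O V t s"
proof -
  have "dj_star V t s t a' w' - dj_star V t s t a w
      = dj_star V t s t (a' - a) w' + dj_star V t s t a (w' - w)"
    by (simp add: module_hom.diff[OF linear_map_dj_star_right]
        module_hom.diff[OF linear_map_dj_star_left])
  also have "\<dots> \<in> dj_O V t s"
    using assms(3,4) by (intro subspace_add[OF subspace_dj_O] dj_star_dj_O_mem_dj_O
        dj_O1_dj_star_mem_dj_O) (auto simp: zhu_O_eq_dj_O1)
  finally show *: "dj_star V t s t a' w' - dj_star V t s t a w \<in> dj_O V t s" .
  show "star_n V n a' w' - dj_star V t s t a w \<in> dj_O V t s"
    using subspace_add[OF subspace_dj_O
        subsetD[OF dj_O_supersets(1) star_n_cong_dj_star[OF assms(1,2), of a' w']] *]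
    by simp
qed

lemma right_star_n_coset:
  assumes "s \<le> n" "t \<le> n" "a' - a \<in> zhu_O V s" "w' - w \<in> dj_O V t s"
  shows "dj_star V t s s w' a' - dj_star V t s s w a \<in> dj_O V t s"
    and "right_star_n V n w' a' - dj_star V t s s w a \<in> dj_O V t s"
proof -
  have "dj_star V t s s w' a' - dj_star V t s s w a
      = dj_star V t s s w' (a' - a) + dj_star V t s s (w' - w) a"
    by (simp add: module_hom.diff[OF linear_map_dj_star_right]
        module_hom.diff[OF linear_map_dj_star_left])
  also have "\<dots> \<in> dj_O V t s"
    using assms(3,4) by (intro subspace_add[OF subspace_dj_O] dj_star_dj_O1_mem_dj_O
        dj_O_dj_star_mem_dj_O) (auto simp: zhu_O_eq_dj_O1)
  finally show *: "dj_star V t s s w' a' - dj_star V t s s w a \<in> dj_O V t s" .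
  show "right_star_n V n w' a' - dj_star V t s s w a \<in> dj_O V t s"
    using subspace_add[OF subspace_dj_O
        subsetD[OF dj_O_supersets(1) right_star_n_cong_dj_star[OF assms(1,2), of w' a']] *]
    by simp
qed

text \<open>A dummy first argument makes scaling a binary operation, so that the lemmas on
  \<open>induced_op\<close> cover it too.\<close>

lemma quotient_scal_eq_induced_op:
  "quotient_scal V W c X = induced_op (\<lambda>_. smul V c) W (0 +o {0}) X"
  by (simp add: quotient_scal_def induced_op_def)

lemma quotient_map_bimodule_epi:
  assumes "s \<le> n" "t \<le> n"
  shows "quotient_map (dj_O V t s)
      \<in> bimodule_epi (zhu_A V n) (zhu_A V n) (bold_A V n) (dj_A_at V n t s)"
proof -
  let ?W = "dj_O V t s" and ?U = "bold_O V n"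
  note W = subspace_dj_O[of t s]
  have UW: "?U \<subseteq> ?W"
    using bold_O_subset_dj_O1[OF assms] dj_O_supersets(1) by blast
  have U: "subspace ?U" by (simp add: bold_O_def)
  have zero: "0 \<in> ?U" "0 \<in> ?W" "0 \<in> zhu_O V m" for m
    using subspace_0 U W by (simp_all add: zhu_O_def span_zero)
  note map_coset = quotient_map_coset[OF W zero(1) UW]
  note map_op = quotient_map_induced_op[OF W zero(1) UW]
  have zhu: "quotient_map (zhu_O V m) (a +o zhu_O V n) = a +o zhu_O V m" if "m \<le> n" for m a
    by (rule quotient_map_coset[OF _ zero(3) zhu_O_antimono[OF that]]) (simp add: zhu_O_def)
  have image: "quotient_map ?W ` quotient_carrier ?U = quotient_carrier ?W"
    by (simp add: quotient_carrier_def image_image map_coset)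
  have "quotient_map ?W (X + Y) = quotient_map ?W X + quotient_map ?W Y" for X Y
  proof -
    have "?W + ?W = ?W" by (rule subspace_absorb[OF W zero(2) order_refl])
    then have "X + Y + ?W = X + Y + (?W + ?W)" by simp
    also have "\<dots> = (X + ?W) + (Y + ?W)" by (simp only: add_ac)
    finally show ?thesis by (simp add: quotient_map_def)
  qed
  moreover have "quotient_map ?W (quotient_scal V ?U c (x +o ?U))
      = quotient_scal V ?W c (quotient_map ?W (x +o ?U))" for c x
    unfolding map_coset quotient_scal_eq_induced_op map_op
    by (subst (1 2) induced_op_coset[where c = "smul V c x", OF W])
      (use zero UW in \<open>auto simp: scale_right_distrib intro: subspace_scale[OF W]\<close>)
  moreover have "quotient_map ?W (induced_op (star_n V n) ?U (a +o zhu_O V n) (x +o ?U))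
      = induced_op (dj_star V t s t) ?W (quotient_map (zhu_O V t) (a +o zhu_O V n))
          (quotient_map ?W (x +o ?U))" for a x
    unfolding map_coset map_op zhu[OF assms(2)]
    \<comment> \<open>Both sides are evaluated to the coset of \<open>dj_star V t s t a x\<close>:
      on the left \<open>star_n\<close> acts on cosets of the smaller subspaces, on the right
      \<open>dj_star\<close> on those of the larger ones.\<close>
    by (subst (1 2) induced_op_coset[where c = "dj_star V t s t a x", OF W])
      (use zero UW zhu_O_antimono[OF assms(2)] in \<open>auto intro!: star_n_coset assms\<close>)
  moreover have "quotient_map ?W (induced_op (right_star_n V n) ?U (x +o ?U) (a +o zhu_O V n))
      = induced_op (dj_star V t s s) ?W (quotient_map ?W (x +o ?U))
          (quotient_map (zhu_O V s) (a +o zhu_O V n))" for a x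
    unfolding map_coset map_op zhu[OF assms(1)]
    by (subst (1 2) induced_op_coset[where c = "dj_star V t s s x a", OF W])
      (use zero UW zhu_O_antimono[OF assms(1)] in \<open>auto intro!: right_star_n_coset assms\<close>)
  moreover have "quotient_map ?W \<in> quotient_carrier ?U \<rightarrow> quotient_carrier ?W"
    using image by blast
  moreover have "(\<forall>X\<in>quotient_carrier S. P X) \<longleftrightarrow> (\<forall>v. P (v +o S))" for S :: "'v set" and P
    by (simp add: quotient_carrier_def)
  ultimately show ?thesis
    using image
    by (simp add: bimodule_epi_def bimodule_hom_def bold_A_def dj_A_at_def dj_A_def zhu_A_def
        restrict_scalars_def)
qed

end

theorem mainTheorem5:
  fixes V :: "'v::ab_group_add vertex_data" and n s t :: nat
  assumes "vertex_operator_algebra V" and "s \<le> n" and "t \<le> n"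
  shows "bold_O V n \<subseteq> dj_O V t s \<and>
    (\<forall>w. quotient_map (dj_O V t s) (w +o bold_O V n) = w +o dj_O V t s) \<and>
    quotient_map (dj_O V t s)
      \<in> bimodule_epi (zhu_A V n) (zhu_A V n) (bold_A V n) (dj_A_at V n t s)"
proof -
  interpret vertex_operator_algebra V by fact
  have sub: "bold_O V n \<subseteq> dj_O V t s"
    using bold_O_subset_dj_O1[OF assms(2,3)] dj_O_supersets(1) by blast
  have "0 \<in> bold_O V n" by (simp add: bold_O_def span_zero)
  then show ?thesis
    using sub quotient_map_coset[OF subspace_dj_O _ sub] quotient_map_bimodule_epi[OF assms(2,3)]
    by simp
qed

end
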